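(* Let $\mathbb{P}$ be the unique Gibbs measure on $\Omega=\mathcal{A}^{\mathbb{Z}}$ with interaction $U\in\mathcal{U}$, let $\alpha = p(U)-\frac{p(2U)}{2}$ (which is strictly positive) and $k^*(n)=\frac{\ln n}{\alpha}$. Let $N(\sigma,n,k)$ be the number of shift-matches of length $k$ up to $n$, regarded as a random variable under $\mathbb{P}$. Let $\{k(n)\}_{n\in\mathbb{N}}$ be a sequence of integers. Then: 1. If $k^*(n)-k(n)\to\infty$ as $n\to\infty$, then for every positive integer $m$, $\lim_{n\to\infty}\mathbb{P}(N(\sigma,n,k(n))\le m)=0$. 2. If $k(n)-k^*(n)\to\infty$ as $n\to\infty$, then for every positive integer $m$, $\lim_{n\to\infty}\mathbb{P}(N(\sigma,n,k(n))\ge m)=0$. 3. If $k(n)-k^*(n)$ is bounded, then $N(\sigma,n,k(n))$ is tight and does not converge to zero in distribution. More precisely, there exists a constant $C>0$ such that for every positive integer $m$ $$\limsup_{n\to\infty}\mathbb{P}(N(\sigma,n,k(n))>m)\le \frac{C}{m},$$ and $$\liminf_{n\to\infty}\mathbb{P}(N(\sigma,n,k(n))>0)>0.$$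
   Context: $\mathcal{A}$ is a finite set with at least two elements; $\Omega=\mathcal{A}^{\mathbb{Z}}$ with the product topology and product sigma-field; $\mathcal{S}$ is the set of (nonempty) finite subsets of $\mathbb{Z}$; for $V\subseteq\mathbb{Z}$, $\sigma_V$ is the restriction of $\sigma\in\Omega$ to $V$, $\Omega_V=\mathcal{A}^V$, and $\mathcal{F}_V$ is the sigma-field generated by $\{\sigma(i):i\in V\}$. The shift is $(\tau_i\sigma)(j)=\sigma(i+j)$. $\operatorname{diam}(A)=\max\{|i-j|:i,j\in A\}$. $C_k=\{1,\dots,k\}$. Interactions: $\mathcal{U}$ is the set of maps $U:\mathcal{S}\times\Omega\to\mathbb{R}$ such that (i) $\sigma\mapsto U(A,\sigma)$ is $\mathcal{F}_A$-measurable for all $A\in\mathcal{S}$; (ii) $U(A+i,\tau_{-i}\sigma)=U(A,\sigma)$ for all $A\in\mathcal{S}$, $i\in\mathbb{Z}$, $\sigma\in\Omega$; (iii) there is $\gamma>0$ with $\sum_{A\ni 0}e^{\gamma\operatorname{diam}(A)}\sup_{\sigma\in\Omega}|U(A,\sigma)|<\infty$. For real $q$, $(qU)(A,\sigma)=q\,U(A,\sigma)$. Gibbs measures: for $\Lambda\in\mathcal{S}$, $\zeta\in\Omega$, put $H_\Lambda^\zeta(\sigma)=\sum_{A\cap\Lambda\ne\varnothing}U(A,\sigma_\Lambda\zeta_{\Lambda^c})$, where $\sigma_\Lambda\zeta_{\Lambda^c}$ equals $\sigma$ on $\Lambda$ and $\zeta$ off $\Lambda$. A probability measure $\mathbb{P}$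 on $\Omega$ is a Gibbs measure with interaction $U$ if for all $\Lambda\in\mathcal{S}$ the conditional distribution of $\sigma_\Lambda$ given $\sigma_{\Lambda^c}=\zeta_{\Lambda^c}$ is, for $\mathbb{P}$-a.e. $\zeta$, given by the weights $e^{-H_\Lambda^\zeta(\sigma)}/\sum_{\sigma'_\Lambda\in\Omega_\Lambda}e^{-H_\Lambda^\zeta(\sigma')}$. For $U\in\mathcal{U}$ there is exactly one Gibbs measure with interaction $U$. Pressure: $p(U)=\lim_{n\to\infty}\frac1n\log\sum_{\sigma_{C_n}\in\Omega_{C_n}}\exp\bigl(-\sum_{A\subseteq C_n}U(A,\sigma)\bigr)$. Number of shift-matches: for integers $1\le k\le n$, $N(\sigma,n,k)=\frac12\sum_{i=0}^{n-k}\sum_{j=0,\,j\ne i}^{n-k}\mathbb{1}\{(\tau_i\sigma)_{C_k}=(\tau_j\sigma)_{C_k}\}$, i.e. the number of pairs $0\le i<j\le n-k$ with $\sigma(i+l)=\sigma(j+l)$ for all $l=1,\dots,k$. Sequences $k(n)$ are understood to satisfy $1\le k(n)\le n$ for all sufficiently large $n$, so that $N(\sigma,n,k(n))$ is defined. *)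

theory Defs
  imports "HOL-Probability.Probability"
begin

text \<open>
  The alphabet is a type \<open>'a\<close> of class \<open>finite\<close>, and a configuration is a function \<open>int \<Rightarrow> 'a\<close>.
\<close>

definition config_space :: "(int \<Rightarrow> 'a) measure" where
  "config_space = (\<Pi>\<^sub>M i\<in>UNIV. count_space UNIV)"

definition coord_algebra :: "int set \<Rightarrow> (int \<Rightarrow> 'a) measure" where
  "coord_algebra V = sigma UNIV {(\<lambda>\<sigma>. \<sigma> i) -` B | i B. i \<in> V}"

definition shift :: "int \<Rightarrow> (int \<Rightarrow> 'a) \<Rightarrow> int \<Rightarrow> 'a" where
  "shift i \<sigma> = (\<lambda>j. \<sigma> (i + j))"

definition fin_sets :: "int set set" where
  "fin_sets = {A. finite A \<and> A \<noteq> {}}"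

definition diam :: "int set \<Rightarrow> int" where
  "diam A = Max {\<bar>i - j\<bar> | i j. i \<in> A \<and> j \<in> A}"

text \<open>
  The values of an interaction on sets outside \<^const>\<open>fin_sets\<close> are unconstrained and never used.
  The real-valued supremum in the third condition is a genuine one: by the first condition
  \<open>U A\<close> depends only on the finitely many coordinates in \<open>A\<close>, hence takes finitely many values.
\<close>

definition interactions :: "(int set \<Rightarrow> (int \<Rightarrow> 'a::finite) \<Rightarrow> real) set" where
  "interactions = {U.
     (\<forall>A\<in>fin_sets. U A \<in> borel_measurable (coord_algebra A)) \<and>
     (\<forall>A\<in>fin_sets. \<forall>i \<sigma>. U ((\<lambda>a. a + i) ` A) (shift (- i) \<sigma>) = U A \<sigma>) \<and>
     (\<exists>\<gamma>>0. (\<lambda>A. exp (\<gamma> * real_of_int (diam A)) * (SUP \<sigma>. \<bar>U A \<sigma>\<bar>)) summable_on {A\<in>fin_sets. 0 \<in> A})}"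

text \<open>
  \<open>override_on \<zeta> \<sigma> \<Lambda>\<close> is the configuration that equals \<open>\<sigma>\<close> on \<open>\<Lambda>\<close> and \<open>\<zeta>\<close> off \<open>\<Lambda>\<close>.
\<close>

definition hamiltonian ::
  "(int set \<Rightarrow> (int \<Rightarrow> 'a) \<Rightarrow> real) \<Rightarrow> int set \<Rightarrow> (int \<Rightarrow> 'a) \<Rightarrow> (int \<Rightarrow> 'a) \<Rightarrow> real" where
  "hamiltonian U \<Lambda> \<zeta> \<sigma> =
     (\<Sum>\<^sub>\<infinity>A\<in>{A\<in>fin_sets. A \<inter> \<Lambda> \<noteq> {}}. U A (override_on \<zeta> \<sigma> \<Lambda>))"

definition gibbs_weight ::
  "(int set \<Rightarrow> (int \<Rightarrow> 'a::finite) \<Rightarrow> real) \<Rightarrow> int set \<Rightarrow> (int \<Rightarrow> 'a) \<Rightarrow> (int \<Rightarrow> 'a) \<Rightarrow> real" where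
  "gibbs_weight U \<Lambda> \<zeta> \<sigma> =
     exp (- hamiltonian U \<Lambda> \<zeta> \<sigma>) / (\<Sum>\<sigma>'\<in>\<Lambda> \<rightarrow>\<^sub>E UNIV. exp (- hamiltonian U \<Lambda> \<zeta> \<sigma>'))"

text \<open>
  The conditional distribution of the finitely-valued \<open>\<sigma>\<^sub>\<Lambda>\<close> given the coordinates off \<open>\<Lambda>\<close> is described
  by the conditional probabilities of its values \<open>\<eta>\<close>, i.e. by the conditional expectations of
  the indicators of \<open>{\<sigma>. \<sigma>\<^sub>\<Lambda> = \<eta>}\<close> given \<open>coord_algebra (- \<Lambda>)\<close>.
\<close>

definition gibbs_measure ::
  "(int set \<Rightarrow> (int \<Rightarrow> 'a::finite) \<Rightarrow> real) \<Rightarrow> (int \<Rightarrow> 'a) measure \<Rightarrow> bool" where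
  "gibbs_measure U P \<longleftrightarrow>
     prob_space P \<and> sets P = sets config_space \<and>
     (\<forall>\<Lambda>\<in>fin_sets. \<forall>\<eta>\<in>\<Lambda> \<rightarrow>\<^sub>E UNIV. AE \<zeta> in P.
        real_cond_exp P (coord_algebra (- \<Lambda>)) (indicator {\<sigma>. restrict \<sigma> \<Lambda> = \<eta>}) \<zeta>
          = gibbs_weight U \<Lambda> \<zeta> \<eta>)"

text \<open>
  A word in \<open>{1..n} \<rightarrow>\<^sub>E UNIV\<close> is a total function, so \<open>U A\<close> applies to it directly; its value is
  that of any configuration extending the word, since only sets \<open>A \<subseteq> {1..n}\<close> occur.
\<close>

definition pressure :: "(int set \<Rightarrow> (int \<Rightarrow> 'a::finite) \<Rightarrow> real) \<Rightarrow> real" where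
  "pressure U = lim (\<lambda>n. 1 / real n *
     ln (\<Sum>\<sigma>\<in>{1..int n} \<rightarrow>\<^sub>E UNIV. exp (- (\<Sum>A\<in>{A\<in>fin_sets. A \<subseteq> {1..int n}}. U A \<sigma>))))"

definition match_rate :: "(int set \<Rightarrow> (int \<Rightarrow> 'a::finite) \<Rightarrow> real) \<Rightarrow> real" where
  "match_rate U = pressure U - pressure (\<lambda>A \<sigma>. 2 * U A \<sigma>) / 2"

definition critical_length :: "(int set \<Rightarrow> (int \<Rightarrow> 'a::finite) \<Rightarrow> real) \<Rightarrow> nat \<Rightarrow> real" where
  "critical_length U n = ln (real n) / match_rate U"

text \<open>The number of shift-matches, meant for \<open>1 \<le> k \<le> n\<close>.\<close>

definition shift_matches :: "(int \<Rightarrow> 'a) \<Rightarrow> nat \<Rightarrow> int \<Rightarrow> real" where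
  "shift_matches \<sigma> n k =
     1 / 2 * (\<Sum>i\<in>{0..int n - k}. \<Sum>j\<in>{0..int n - k} - {i}.
        of_bool (restrict (shift i \<sigma>) {1..k} = restrict (shift j \<sigma>) {1..k}))"

end

theory Submission
  imports Defs
begin

text \<open>
  Conditionally on everything outside an interval of length \<open>n\<close>, each word \<open>x\<close> on it has
  probability comparable, with constants independent of the interval, of \<open>n\<close> and of the boundary
  condition, to \<open>exp (- energy x)\<close> divided by the partition sum: the energy across the two end
  points is bounded.  The sum of the squares of these weights is comparable to
  \<open>exp (- 2 * \<alpha> * n)\<close>.  If an event lets the words on two disjoint sets of sites \<open>S\<close>, \<open>T\<close> determine
  each other, the Cauchy--Schwarz inequality bounds its probability by a constant times
  \<open>exp (- \<alpha> * (card S + card T))\<close>; this covers all overlaps, both for one match (first moment) and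
  for two matches (second moment).  With \<open>x = n * exp (- \<alpha> * k)\<close> the expected number of matches is
  of order at most \<open>x\<^sup>2 + x\<close>, and the second moment method gives a match with probability bounded
  below once \<open>x\<close> is, uniformly in the configuration outside; subcritically this is iterated over
  many disjoint blocks.
\<close>

section \<open>Coordinate algebras and words\<close>

text \<open>A set has as many translates straddling a given cut as its diameter, and the exponential
  factor in the summability condition dominates that number; hence the bounded energy across a cut.
  The errors in the logarithms of partition sums are then bounded and not merely of order o(n),
  which is what locates the threshold up to bounded shifts of \<open>k\<close>. The comparison
  constants do not tend to 1, so the second moment yields a match only with some fixed positive
  probability, never with probability near 1. This is why the estimates carry an arbitrary event
  \<open>R\<close> of the outside: the failure of earlier blocks can play the role of
  \<open>R\<close> for the next one. In the second moment the starting points of the two matched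
  words are taken from two separated windows, so that overlaps between different matches occur only
  inside one window.\<close>

lemma space_coord_algebra [simp]: "space (coord_algebra V) = UNIV"
  by (simp add: coord_algebra_def space_measure_of_conv)

lemma sets_coord_algebra:
  "sets (coord_algebra V) = sigma_sets UNIV {(\<lambda>\<sigma>. \<sigma> i) -` B | i B. i \<in> V}"
  by (simp add: coord_algebra_def)

lemma coord_algebra_mono: "V \<subseteq> W \<Longrightarrow> sets (coord_algebra V) \<subseteq> sets (coord_algebra W)"
  unfolding sets_coord_algebra by (rule sigma_sets_mono') auto

lemma coord_algebra_saturated:
  assumes "X \<in> sets (coord_algebra V)" and "\<And>i. i \<in> V \<Longrightarrow> \<sigma> i = \<sigma>' i"
  shows "\<sigma> \<in> X \<longleftrightarrow> \<sigma>' \<in> X"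
  using assms(1) unfolding sets_coord_algebra
  by (induction rule: sigma_sets.induct) (use assms(2) in auto)

lemma borel_measurable_coord_algebra_local:
  fixes f :: "(int \<Rightarrow> 'a) \<Rightarrow> real"
  assumes "f \<in> borel_measurable (coord_algebra V)" and "\<And>i. i \<in> V \<Longrightarrow> \<sigma> i = \<sigma>' i"
  shows "f \<sigma> = f \<sigma>'"
proof -
  have "f -` {f \<sigma>} \<in> sets (coord_algebra V)"
    using measurable_sets[OF assms(1), of "{f \<sigma>}"] by simp
  then have "\<sigma> \<in> f -` {f \<sigma>} \<longleftrightarrow> \<sigma>' \<in> f -` {f \<sigma>}"
    using assms(2) by (rule coord_algebra_saturated)
  then show ?thesis by auto
qed

text \<open>There are only finitely many words on \<open>V\<close>, so a set that depends only on
  these sites is a finite union of cylinders. Measurability of cylinders and of matches rests on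
  this.\<close>

lemma coord_algebra_finiteI:
  fixes X :: "(int \<Rightarrow> 'a::finite) set"
  assumes "finite V"
    and sat: "\<And>\<sigma> \<sigma>'. \<sigma> \<in> X \<Longrightarrow> (\<And>i. i \<in> V \<Longrightarrow> \<sigma> i = \<sigma>' i) \<Longrightarrow> \<sigma>' \<in> X"
  shows "X \<in> sets (coord_algebra V)"
proof -
  have [measurable]: "Measurable.pred (coord_algebra V) (\<lambda>\<sigma>. \<sigma> i = a)" if "i \<in> V" for i and a :: 'a
  proof -
    have "{\<sigma>. \<sigma> i = a} = (\<lambda>\<sigma>. \<sigma> i) -` {a}" by auto
    then have "{\<sigma>. \<sigma> i = a} \<in> sets (coord_algebra V)"
      using that unfolding sets_coord_algebra by (intro sigma_sets.Basic) blast
    then show ?thesis by (simp add: pred_def)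
  qed
  have cyl: "{\<sigma>. \<forall>i\<in>V. \<sigma> i = x i} \<in> sets (coord_algebra V)" for x :: "int \<Rightarrow> 'a"
  proof -
    have "Measurable.pred (coord_algebra V) (\<lambda>\<sigma>. \<forall>i\<in>V. \<sigma> i = x i)"
      using assms(1) by (intro pred_intros_finite) simp_all
    then show ?thesis by (simp add: pred_def)
  qed
  have "X = (\<Union>x\<in>(\<lambda>\<sigma>. restrict \<sigma> V) ` X. {\<sigma>. \<forall>i\<in>V. \<sigma> i = x i})"
    using sat by (auto; metis)
  moreover have "finite ((\<lambda>\<sigma>. restrict \<sigma> V) ` X)"
    by (rule finite_subset[of _ "V \<rightarrow>\<^sub>E UNIV"]) (auto intro: finite_PiE assms(1))
  ultimately show ?thesis using cyl by (metis (no_types, lifting) sets.finite_UN)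
qed

lemma coord_algebra_subset_config_space:
  "sets (coord_algebra V) \<subseteq> sets (config_space :: (int \<Rightarrow> 'a) measure)"
proof -
  have "(\<lambda>\<sigma>::int \<Rightarrow> 'a. \<sigma> i) -` B \<in> sets config_space" for i B
  proof -
    have "(\<lambda>\<sigma>::int \<Rightarrow> 'a. \<sigma> i) \<in> measurable config_space (count_space UNIV)"
      unfolding config_space_def by measurable
    from measurable_sets[OF this, of B] show ?thesis
      by (simp add: config_space_def space_PiM)
  qed
  then have "sigma_sets (space config_space) {(\<lambda>\<sigma>::int \<Rightarrow> 'a. \<sigma> i) -` B | i B. i \<in> V}
      \<subseteq> sets config_space"
    by (intro sets.sigma_sets_subset) auto
  then show ?thesis by (simp add: sets_coord_algebra config_space_def space_PiM)
qed

text \<open>A word on a disjoint union is a pair of words. This factorisation serves for partition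
  sums of adjacent blocks and for the squares in \<open>good_Un\<close>.\<close>

lemma sum_PiE_Un_prod:
  fixes F G :: "('i \<Rightarrow> 'a) \<Rightarrow> 'b::comm_semiring_0"
  assumes "S \<inter> T = {}"
  shows "(\<Sum>x\<in>(S \<union> T) \<rightarrow>\<^sub>E UNIV. F (restrict x S) * G (restrict x T)) =
    (\<Sum>x\<in>S \<rightarrow>\<^sub>E UNIV. F x) * (\<Sum>x\<in>T \<rightarrow>\<^sub>E UNIV. G x)"
proof -
  have "(\<Sum>x\<in>(S \<union> T) \<rightarrow>\<^sub>E UNIV. F (restrict x S) * G (restrict x T)) =
      (\<Sum>(y, z)\<in>(S \<rightarrow>\<^sub>E UNIV) \<times> (T \<rightarrow>\<^sub>E UNIV). F y * G z)"
  proof (rule sum.reindex_bij_witness[where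
        i = "\<lambda>(y, z). restrict (override_on z y S) (S \<union> T)" and
        j = "\<lambda>x. (restrict x S, restrict x T)"], goal_cases)
    case (1 x)
    then show ?case by (auto simp: fun_eq_iff override_on_def PiE_def extensional_def)
  next
    case (3 p)
    then show ?case
      using assms by (auto simp: fun_eq_iff override_on_def PiE_def extensional_def)
  qed auto
  also have "\<dots> = (\<Sum>x\<in>S \<rightarrow>\<^sub>E UNIV. F x) * (\<Sum>x\<in>T \<rightarrow>\<^sub>E UNIV. G x)"
    by (simp add: sum_product sum.cartesian_product)
  finally show ?thesis .
qed

section \<open>Analytic and probabilistic tools\<close>

text \<open>Both \<open>a m / m\<close> and \<open>a n / n\<close> are compared with
  \<open>a (m * n) / (m * n)\<close>, so they differ by at most \<open>D / m + D / n\<close>. This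
  gives the Cauchy property, hence a genuine limit, and \<open>m\<close> tending to infinity gives
  the rate \<open>D / n\<close>.\<close>

lemma almost_additive_limit:
  fixes a :: "nat \<Rightarrow> real"
  assumes add: "\<And>m n. \<bar>a (m + n) - a m - a n\<bar> \<le> D"
  shows "\<bar>a n - real n * lim (\<lambda>n. 1 / real n * a n)\<bar> \<le> D"
proof -
  have "0 \<le> D" using add[of 0 0] by linarith
  have mult: "\<bar>a (Suc m * n) - real (Suc m) * a n\<bar> \<le> real m * D" for m n
  proof (induction m)
    case (Suc m)
    then show ?case using add[of n "Suc m * n"] by (simp add: algebra_simps)
  qed simp
  have scaled: "\<bar>a (m * n) / (real m * real n) - a n / real n\<bar> \<le> D / real n"
    if "m > 0" "n > 0" for m n
  proof -
    from \<open>m > 0\<close> obtain m' where m: "m = Suc m'" by (cases m) auto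
    have "\<bar>a (m * n) - real m * a n\<bar> \<le> real m * D"
      using mult[of m' n] m \<open>0 \<le> D\<close> by (simp add: algebra_simps)
    then have "\<bar>a (m * n) - real m * a n\<bar> / (real m * real n) \<le> real m * D / (real m * real n)"
      by (rule divide_right_mono) simp
    moreover have "a (m * n) / (real m * real n) - a n / real n
        = (a (m * n) - real m * a n) / (real m * real n)"
      using that by (simp add: field_simps)
    ultimately show ?thesis using that by (simp add: abs_mult)
  qed
  have dist: "\<bar>a m / real m - a n / real n\<bar> \<le> D / real m + D / real n" if "m > 0" "n > 0" for m n
    using scaled[OF that] scaled[OF that(2,1)] by (simp add: mult.commute)
  have "Cauchy (\<lambda>n. a n / real n)"
  proof (rule metric_CauchyI)
    fix e :: real assume "e > 0"
    obtain N :: nat where N: "2 * D / e < real N" using reals_Archimedean2 by blast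
    have "dist (a m / real m) (a n / real n) < e" if "m \<ge> Suc N" "n \<ge> Suc N" for m n
    proof -
      have small: "D / real l < e / 2" if "l \<ge> Suc N" for l
      proof -
        have "2 * D / e < real l" using N that by linarith
        then show ?thesis using \<open>e > 0\<close> that by (simp add: field_simps)
      qed
      have "\<bar>a m / real m - a n / real n\<bar> \<le> D / real m + D / real n"
        using that by (intro dist) auto
      with small[OF that(1)] small[OF that(2)] show ?thesis
        unfolding dist_real_def by linarith
    qed
    then show "\<exists>M. \<forall>m\<ge>M. \<forall>n\<ge>M. dist (a m / real m) (a n / real n) < e" by blast
  qed
  then obtain p where p: "(\<lambda>n. a n / real n) \<longlonglongrightarrow> p"
    using Cauchy_convergent convergent_def by blast
  then have lim: "lim (\<lambda>n. 1 / real n * a n) = p" by (simp add: limI)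
  show ?thesis
  proof (cases "n = 0")
    \<comment> \<open>At \<open>n = 0\<close> the claim reads
      \<open>\<bar>a 0\<bar> \<le> D\<close>, which is the hypothesis for 0 + 0.\<close>
    case True
    then show ?thesis using add[of 0 0] by simp
  next
    case False
    have l: "(\<lambda>m. \<bar>a m / real m - a n / real n\<bar>) \<longlonglongrightarrow> \<bar>p - a n / real n\<bar>"
      by (intro tendsto_intros p)
    have u: "(\<lambda>m. D / real m + D / real n) \<longlonglongrightarrow> 0 + D / real n"
      by (intro tendsto_intros lim_const_over_n)
    have "\<bar>p - a n / real n\<bar> \<le> 0 + D / real n"
    proof (rule tendsto_le[OF trivial_limit_sequentially u l])
      show "\<forall>\<^sub>F m in sequentially. \<bar>a m / real m - a n / real n\<bar> \<le> D / real m + D / real n"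
        using eventually_gt_at_top[of 0] by eventually_elim (use dist False in auto)
    qed
    then have "\<bar>p - a n / real n\<bar> * real n \<le> D" using False by (simp add: field_simps)
    moreover have "\<bar>p - a n / real n\<bar> * real n = \<bar>real n * p - a n\<bar>"
      using False by (simp add: abs_if field_simps)
    ultimately show ?thesis unfolding lim by (simp add: abs_minus_commute)
  qed
qed

text \<open>On each side of \<open>i\<close> the distances to \<open>i\<close> are distinct, so each
  side contributes a partial sum of a geometric series, whatever gaps \<open>I\<close> has.\<close>

lemma sum_exp_dist_le:
  fixes \<alpha> :: real
  assumes "\<alpha> > 0" "finite I"
  shows "(\<Sum>j\<in>I. exp (- (\<alpha> * real_of_int \<bar>i - j\<bar>))) \<le> 2 / (1 - exp (- \<alpha>))"
proof -
  define q where "q = exp (- \<alpha>)"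
  have q: "0 < q" "q < 1" using assms by (auto simp: q_def)
  have pow: "exp (- (\<alpha> * real_of_int \<bar>l\<bar>)) = q ^ nat \<bar>l\<bar>" for l
    by (simp add: q_def flip: exp_of_nat_mult)
  have half: "(\<Sum>j\<in>J. q ^ nat \<bar>i - j\<bar>) \<le> 1 / (1 - q)"
    if "finite J" "inj_on (\<lambda>j. nat \<bar>i - j\<bar>) J" for J
  proof -
    have "(\<Sum>j\<in>J. q ^ nat \<bar>i - j\<bar>) = (\<Sum>m\<in>(\<lambda>j. nat \<bar>i - j\<bar>) ` J. q ^ m)"
      by (simp add: sum.reindex that)
    also have "\<dots> \<le> (\<Sum>m. q ^ m)"
      using q that by (intro sum_le_suminf summable_geometric) auto
    also have "\<dots> = 1 / (1 - q)" using q by (intro suminf_geometric) auto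
    finally show ?thesis .
  qed
  have "I = {j\<in>I. j \<le> i} \<union> {j\<in>I. j > i}" by auto
  then have "(\<Sum>j\<in>I. q ^ nat \<bar>i - j\<bar>)
      = (\<Sum>j\<in>{j\<in>I. j \<le> i}. q ^ nat \<bar>i - j\<bar>) + (\<Sum>j\<in>{j\<in>I. j > i}. q ^ nat \<bar>i - j\<bar>)"
    by (subst sum.union_disjoint[symmetric]) (use assms in auto)
  also have "\<dots> \<le> 1 / (1 - q) + 1 / (1 - q)"
    by (intro add_mono half) (use assms in \<open>auto simp: inj_on_def\<close>)
  finally show ?thesis unfolding pow by (simp add: q_def)
qed

text \<open>Cauchy--Schwarz for \<open>N = N * J\<close>, with \<open>N\<close> the number of events
  that occur inside \<open>R\<close> and \<open>J\<close> the indicator that one does. The product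
  form avoids dividing by a second moment that may vanish.\<close>

lemma (in prob_space) second_moment_events:
  assumes "finite X" and A: "\<And>x. x \<in> X \<Longrightarrow> A x \<in> events" and R: "R \<in> events"
  shows "(\<Sum>x\<in>X. prob (A x \<inter> R))\<^sup>2
    \<le> (\<Sum>x\<in>X. \<Sum>y\<in>X. prob (A x \<inter> A y \<inter> R)) * prob ((\<Union>x\<in>X. A x) \<inter> R)"
proof -
  define s1 where "s1 = (\<Sum>x\<in>X. prob (A x \<inter> R))"
  define s2 where "s2 = (\<Sum>x\<in>X. \<Sum>y\<in>X. prob (A x \<inter> A y \<inter> R))"
  define q where "q = prob ((\<Union>x\<in>X. A x) \<inter> R)"
  define N :: "'a \<Rightarrow> real" where "N \<omega> = (\<Sum>x\<in>X. indicator (A x \<inter> R) \<omega>)" for \<omega>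
  define J :: "'a \<Rightarrow> real" where "J = indicator ((\<Union>x\<in>X. A x) \<inter> R)"
  have "(\<Union>x\<in>X. A x) \<inter> R \<in> events" using A R assms(1) by (intro sets.Int sets.finite_UN) auto
  then have J: "integrable M J" "expectation J = q"
    unfolding J_def q_def by (auto simp: less_top[symmetric])
  have N1: "integrable M N" "expectation N = s1"
    unfolding N_def s1_def using A R by (auto simp: less_top[symmetric] integral_sum)
  have sq: "(N \<omega>)\<^sup>2 = (\<Sum>x\<in>X. \<Sum>y\<in>X. indicator (A x \<inter> A y \<inter> R) \<omega>)" for \<omega>
    unfolding N_def power2_eq_square sum_product
    by (intro sum.cong refl) (auto simp: indicator_def)
  have N2: "integrable M (\<lambda>\<omega>. (N \<omega>)\<^sup>2)" "expectation (\<lambda>\<omega>. (N \<omega>)\<^sup>2) = s2"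
    unfolding sq s2_def using A R by (auto simp: less_top[symmetric] integral_sum sets.Int)
  \<comment> \<open>Pointwise this is \<open>(t * N - 1)\<^sup>2 \<ge> 0\<close> where some event
    occurs, and \<open>N = 0\<close> elsewhere. The optimal parameter is
    \<open>t = s1 / s2\<close>.\<close>
  have amgm: "2 * t * s1 \<le> t\<^sup>2 * s2 + q" for t
  proof -
    have "2 * t * N \<omega> \<le> t\<^sup>2 * (N \<omega>)\<^sup>2 + J \<omega>" for \<omega>
    proof (cases "\<omega> \<in> (\<Union>x\<in>X. A x) \<inter> R")
      case True
      then show ?thesis using zero_le_power2[of "t * N \<omega> - 1"]
        by (simp add: J_def power2_eq_square algebra_simps)
    next
      case False
      then have "N \<omega> = 0" unfolding N_def by (intro sum.neutral) auto
      then show ?thesis by (simp add: J_def)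
    qed
    then have "expectation (\<lambda>\<omega>. 2 * t * N \<omega>) \<le> expectation (\<lambda>\<omega>. t\<^sup>2 * (N \<omega>)\<^sup>2 + J \<omega>)"
      using N1 N2 J by (intro integral_mono) auto
    then show ?thesis using N1 N2 J by simp
  qed
  have "s2 \<ge> 0" unfolding s2_def by (intro sum_nonneg) auto
  have "q \<ge> 0" unfolding q_def by simp
  have "s1\<^sup>2 \<le> s2 * q"
  proof (cases "s2 = 0")
    case True
    have "s1 = 0"
    proof (rule ccontr)
      assume "s1 \<noteq> 0"
      \<comment> \<open>This parameter would give \<open>2 * (q + 1) \<le> q\<close>.\<close>
      then show False using amgm[of "(q + 1) / s1"] True \<open>q \<ge> 0\<close> by simp
    qed
    then show ?thesis using True by simp
  next
    case False
    then have "s2 > 0" using \<open>s2 \<ge> 0\<close> by simp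
    have "s1\<^sup>2 / s2 \<le> q"
      using amgm[of "s1 / s2"] \<open>s2 > 0\<close> by (simp add: power2_eq_square field_simps)
    then show ?thesis using \<open>s2 > 0\<close> by (simp add: field_simps)
  qed
  then show ?thesis unfolding s1_def s2_def q_def .
qed

section \<open>Interactions, energies and the pressure\<close>

abbreviation block :: "int \<Rightarrow> nat \<Rightarrow> int set" where
  "block i L \<equiv> {i + 1..i + int L}"

text \<open>The sets broken by the cut between \<open>a\<close> and \<open>a + 1\<close>. A set that
  meets a block without being contained in it crosses one of the two ends of the block.\<close>

definition crossing :: "int \<Rightarrow> int set set" where
  "crossing a = {A\<in>fin_sets. (\<exists>x\<in>A. x \<le> a) \<and> (\<exists>y\<in>A. a < y)}"

definition energy :: "(int set \<Rightarrow> (int \<Rightarrow> 'a) \<Rightarrow> real) \<Rightarrow> int set \<Rightarrow> (int \<Rightarrow> 'a) \<Rightarrow> real" where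
  "energy U S \<sigma> = (\<Sum>A\<in>{A\<in>fin_sets. A \<subseteq> S}. U A \<sigma>)"

definition partition_sum :: "(int set \<Rightarrow> (int \<Rightarrow> 'a) \<Rightarrow> real) \<Rightarrow> int set \<Rightarrow> real" where
  "partition_sum U S = (\<Sum>x\<in>S \<rightarrow>\<^sub>E UNIV. exp (- energy U S x))"

text \<open>The Gibbs weight with free boundary: only sets inside \<open>S\<close> contribute. It is
  the common reference for all boundary conditions.\<close>

definition word_weight :: "(int set \<Rightarrow> (int \<Rightarrow> 'a) \<Rightarrow> real) \<Rightarrow> int set \<Rightarrow> (int \<Rightarrow> 'a) \<Rightarrow> real" where
  "word_weight U S x = exp (- energy U S x) / partition_sum U S"

lemma finite_PiE_UNIV: "finite S \<Longrightarrow> finite (S \<rightarrow>\<^sub>E (UNIV :: 'a::finite set))"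
  by (rule finite_PiE) auto

lemma abs_diff_le_diam:
  assumes "finite A" "i \<in> A" "j \<in> A"
  shows "\<bar>i - j\<bar> \<le> diam A"
proof -
  have "{\<bar>i - j\<bar> | i j. i \<in> A \<and> j \<in> A} = (\<lambda>(i, j). \<bar>i - j\<bar>) ` (A \<times> A)" by auto
  then have "finite {\<bar>i - j\<bar> | i j. i \<in> A \<and> j \<in> A}" using assms by simp
  then show ?thesis unfolding diam_def using assms by (intro Max_ge) auto
qed

lemma diam_nonneg: "A \<in> fin_sets \<Longrightarrow> 0 \<le> diam A"
  using abs_diff_le_diam unfolding fin_sets_def by fastforce

lemma translate_in_fin_sets [simp]: "(+) i ` A \<in> fin_sets \<longleftrightarrow> A \<in> fin_sets"
  by (auto simp: fin_sets_def dest: finite_imageD)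

lemma shift_shift [simp]: "shift i (shift j \<sigma>) = shift (i + j) \<sigma>" "shift 0 \<sigma> = \<sigma>"
  by (auto simp: shift_def fun_eq_iff algebra_simps)

lemma translate_translate [simp]:
  "(+) i ` (+) j ` (A :: int set) = (+) (i + j) ` A" "(+) 0 ` (A :: int set) = A"
  by (auto simp: image_image algebra_simps)

lemma sum_PiE_shift:
  fixes F :: "(int \<Rightarrow> 'a) \<Rightarrow> 'b::comm_monoid_add"
  shows "(\<Sum>x\<in>((+) i ` S) \<rightarrow>\<^sub>E UNIV. F (restrict (shift i x) S)) = (\<Sum>y\<in>S \<rightarrow>\<^sub>E UNIV. F y)"
proof (rule sum.reindex_bij_witness[where
      i = "\<lambda>y. restrict (shift (- i) y) ((+) i ` S)" and j = "\<lambda>x. restrict (shift i x) S"], goal_cases)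
  case (1 x)
  then show ?case
    by (auto simp: fun_eq_iff shift_def PiE_def extensional_def restrict_def image_iff)
next
  case (3 y)
  then show ?case
    by (auto simp: fun_eq_iff shift_def PiE_def extensional_def restrict_def image_iff)
qed auto

text \<open>The quantitative content of an interaction: \<open>w\<close> dominates the values, and
  one constant \<open>D\<close> bounds the total weight at a site and across a cut. Finite families
  stand in for infinite sums. The axioms scale, so twice an interaction is again an
  instance.\<close>

locale interaction =
  fixes U :: "int set \<Rightarrow> (int \<Rightarrow> 'a::finite) \<Rightarrow> real" and w :: "int set \<Rightarrow> real" and D :: real
  assumes local: "A \<in> fin_sets \<Longrightarrow> (\<And>i. i \<in> A \<Longrightarrow> \<sigma> i = \<sigma>' i) \<Longrightarrow> U A \<sigma> = U A \<sigma>'"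
    and translate: "A \<in> fin_sets \<Longrightarrow> U ((+) i ` A) \<sigma> = U A (shift i \<sigma>)"
    and bound: "A \<in> fin_sets \<Longrightarrow> \<bar>U A \<sigma>\<bar> \<le> w A"
    and site: "finite F \<Longrightarrow> F \<subseteq> {A\<in>fin_sets. i \<in> A} \<Longrightarrow> sum w F \<le> D"
    and cross: "finite F \<Longrightarrow> F \<subseteq> crossing a \<Longrightarrow> sum w F \<le> D"

text \<open>For a site, translation moves it to 0 and the exponential factor is at least 1. For a
  cut, sets are grouped by their translate with minimum 0; each group has at most
  \<open>diam\<close> members, and
  \<open>\<gamma> * diam \<le> exp (\<gamma> * diam)\<close>.\<close>

lemma interactions_imp_interaction:
  notes uminus_add_conv_diff [simp del]
  fixes U :: "int set \<Rightarrow> (int \<Rightarrow> 'a::finite) \<Rightarrow> real"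
  assumes "U \<in> interactions"
  obtains w D where "interaction U w D"
proof -
  have loc: "U A \<sigma> = U A \<sigma>'" if "A \<in> fin_sets" "\<And>i. i \<in> A \<Longrightarrow> \<sigma> i = \<sigma>' i" for A \<sigma> \<sigma>'
    using assms that borel_measurable_coord_algebra_local unfolding interactions_def by blast
  have transl: "U ((+) i ` A) \<sigma> = U A (shift i \<sigma>)" if "A \<in> fin_sets" for A i \<sigma>
  proof -
    have "U ((\<lambda>a. a + i) ` A) (shift (- i) (shift i \<sigma>)) = U A (shift i \<sigma>)"
      using assms that unfolding interactions_def by blast
    moreover have "(\<lambda>a. a + i) ` A = (+) i ` A" by (simp add: add.commute)
    ultimately show ?thesis by simp
  qed
  define w where "w A = (SUP \<sigma>. \<bar>U A \<sigma>\<bar>)" for A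
  have bnd: "\<bar>U A \<sigma>\<bar> \<le> w A" if "A \<in> fin_sets" for A \<sigma>
  proof -
    \<comment> \<open>Locality leaves finitely many values, so the supremum really is an upper
      bound.\<close>
    have "range (\<lambda>\<sigma>. \<bar>U A \<sigma>\<bar>) \<subseteq> (\<lambda>x. \<bar>U A x\<bar>) ` (A \<rightarrow>\<^sub>E UNIV)"
    proof safe
      fix \<sigma>
      have "U A \<sigma> = U A (restrict \<sigma> A)" by (rule loc[OF that]) auto
      then show "\<bar>U A \<sigma>\<bar> \<in> (\<lambda>x. \<bar>U A x\<bar>) ` (A \<rightarrow>\<^sub>E UNIV)" by auto
    qed
    moreover have "finite (A \<rightarrow>\<^sub>E (UNIV :: 'a set))"
      using that by (intro finite_PiE_UNIV) (simp add: fin_sets_def)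
    ultimately have "finite (range (\<lambda>\<sigma>. \<bar>U A \<sigma>\<bar>))" by (meson finite_imageI finite_subset)
    then show ?thesis unfolding w_def by (intro cSUP_upper) auto
  qed
  have w_nonneg: "0 \<le> w A" if "A \<in> fin_sets" for A using bnd[OF that] abs_ge_zero order_trans by blast
  have w_transl: "w ((+) i ` A) = w A" if "A \<in> fin_sets" for A i
  proof -
    have "range (\<lambda>\<sigma>. \<bar>U A (shift i \<sigma>)\<bar>) = range (\<lambda>\<sigma>. \<bar>U A \<sigma>\<bar>)"
    proof safe
      fix \<sigma>
      have "U A \<sigma> = U A (shift i (shift (- i) \<sigma>))" by simp
      then show "\<bar>U A \<sigma>\<bar> \<in> range (\<lambda>\<sigma>. \<bar>U A (shift i \<sigma>)\<bar>)" by (metis rangeI)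
    qed auto
    then show ?thesis unfolding w_def using that by (simp add: transl)
  qed
  obtain \<gamma> where \<gamma>: "\<gamma> > 0"
    and "(\<lambda>A. exp (\<gamma> * real_of_int (diam A)) * w A) summable_on {A\<in>fin_sets. 0 \<in> A}"
    using assms unfolding interactions_def w_def by blast
  then obtain K where K: "\<And>F. finite F \<Longrightarrow> F \<subseteq> {A\<in>fin_sets. 0 \<in> A} \<Longrightarrow>
      (\<Sum>A\<in>F. exp (\<gamma> * real_of_int (diam A)) * w A) \<le> K"
    using finite_sum_le_infsum w_nonneg by (metis (no_types, lifting) Diff_iff exp_ge_zero mem_Collect_eq mult_nonneg_nonneg)
  have "K \<ge> 0" using K[of "{}"] by simp
  have site: "sum w F \<le> K" if F: "finite F" "F \<subseteq> {A\<in>fin_sets. i \<in> A}" for F i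
  proof -
    have inj: "inj_on ((`) ((+) (- i))) F"
      by (rule inj_on_inverseI[where g = "(`) ((+) i)"]) (simp add: image_image)
    have "sum w F = (\<Sum>A\<in>F. w ((+) (- i) ` A))"
      using F by (intro sum.cong refl w_transl[symmetric]) auto
    also have "\<dots> = (\<Sum>A\<in>(`) ((+) (- i)) ` F. w A)" by (simp add: sum.reindex[OF inj])
    also have "\<dots> \<le> (\<Sum>A\<in>(`) ((+) (- i)) ` F. exp (\<gamma> * real_of_int (diam A)) * w A)"
    proof (rule sum_mono)
      fix A assume "A \<in> (`) ((+) (- i)) ` F"
      then have A: "A \<in> fin_sets" using F by auto
      have "1 \<le> exp (\<gamma> * real_of_int (diam A))" using \<gamma> diam_nonneg[OF A] by simp
      then show "w A \<le> exp (\<gamma> * real_of_int (diam A)) * w A"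
        using w_nonneg[OF A] mult_right_mono by fastforce
    qed
    also have "\<dots> \<le> K" using F by (intro K) (auto simp: image_iff intro!: bexI[of _ i])
    finally show ?thesis .
  qed
  have cross: "sum w F \<le> K / \<gamma>" if F: "finite F" "F \<subseteq> crossing a" for F a
  proof -
    have fin: "A \<in> fin_sets" "finite A" "A \<noteq> {}" if "A \<in> F" for A
      using F that by (auto simp: crossing_def fin_sets_def)
    have Min_le_a: "Min C \<le> a" if "C \<in> F" for C
    proof -
      obtain x where "x \<in> C" "x \<le> a" using \<open>C \<in> F\<close> F by (auto simp: crossing_def)
      then show ?thesis using Min_le[OF fin(2)[OF that]] by force
    qed
    define base where "base A = (+) (- Min A) ` A" for A :: "int set"
    \<comment> \<open>Shape and position determine a crossing set; \<open>nat\<close> loses nothing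
      because \<open>Min A \<le> a\<close>.\<close>
    define pos where "pos A = (base A, nat (a - Min A))" for A
    have "inj_on pos F"
    proof (rule inj_onI)
      fix A B assume AB: "A \<in> F" "B \<in> F" "pos A = pos B"
      have "Min A \<le> a" "Min B \<le> a" using AB Min_le_a by auto
      with AB have "Min A = Min B" by (simp add: pos_def eq_nat_nat_iff)
      with AB have "(+) (Min A) ` base A = (+) (Min A) ` base B" by (simp add: pos_def)
      then show "A = B" using \<open>Min A = Min B\<close> by (simp add: base_def)
    qed
    have "sum w F = (\<Sum>A\<in>F. w (fst (pos A)))"
      unfolding pos_def base_def fst_conv by (intro sum.cong refl w_transl[symmetric] fin)
    also have "\<dots> = (\<Sum>p\<in>pos ` F. w (fst p))"
      by (simp add: sum.reindex[OF \<open>inj_on pos F\<close>])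
    also have "\<dots> \<le> (\<Sum>p\<in>Sigma (base ` F) (\<lambda>B. {..<nat (diam B)}). w (fst p))"
    proof (rule sum_mono2)
      \<comment> \<open>Some point of the set lies strictly beyond \<open>a\<close>, so the distance
        from the minimum to \<open>a\<close> is strictly less than the diameter.\<close>
      show "pos ` F \<subseteq> Sigma (base ` F) (\<lambda>B. {..<nat (diam B)})"
      proof safe
        fix A B t assume A: "A \<in> F" "(B, t) = pos A"
        then show "B \<in> base ` F" by (simp add: pos_def)
        obtain y where y: "y \<in> A" "a < y" using A F by (auto simp: crossing_def)
        have "Min A \<in> A" using fin[OF A(1)] by simp
        then have "- Min A + Min A \<in> base A" "- Min A + y \<in> base A"
          using y unfolding base_def by blast+
        then have "\<bar>(- Min A + Min A) - (- Min A + y)\<bar> \<le> diam (base A)"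
          using fin[OF A(1)] by (intro abs_diff_le_diam) (simp_all add: base_def)
        then have "a - Min A < diam (base A)" "0 < diam (base A)"
          using y Min_le_a[OF A(1)] by linarith+
        then show "t < nat (diam B)" using A by (simp add: pos_def zless_nat_conj)
      qed
    qed (use F fin w_nonneg in \<open>auto simp: base_def\<close>)
    also have "\<dots> = (\<Sum>B\<in>base ` F. real (nat (diam B)) * w B)"
      using F sum.Sigma[of "base ` F" "\<lambda>B. {..<nat (diam B)}" "\<lambda>B _. w B"]
      by (simp add: case_prod_unfold)
    also have "\<dots> \<le> (\<Sum>B\<in>base ` F. exp (\<gamma> * real_of_int (diam B)) * w B / \<gamma>)"
    proof (rule sum_mono)
      fix B assume "B \<in> base ` F"
      then have B: "B \<in> fin_sets" using fin by (auto simp: base_def)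
      have "\<gamma> * real_of_int (diam B) \<le> exp (\<gamma> * real_of_int (diam B))"
        using exp_ge_add_one_self[of "\<gamma> * real_of_int (diam B)"] by linarith
      then have "real (nat (diam B)) \<le> exp (\<gamma> * real_of_int (diam B)) / \<gamma>"
        using \<gamma> diam_nonneg[OF B] by (simp add: field_simps)
      from mult_right_mono[OF this w_nonneg[OF B]]
      show "real (nat (diam B)) * w B \<le> exp (\<gamma> * real_of_int (diam B)) * w B / \<gamma>" by simp
    qed
    also have "\<dots> = (\<Sum>B\<in>base ` F. exp (\<gamma> * real_of_int (diam B)) * w B) / \<gamma>"
      by (simp add: sum_divide_distrib)
    also have "\<dots> \<le> K / \<gamma>"
    proof (intro divide_right_mono K)
      show "base ` F \<subseteq> {A \<in> fin_sets. 0 \<in> A}"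
      proof safe
        fix A assume A: "A \<in> F"
        show "base A \<in> fin_sets" using fin[OF A] by (simp add: base_def)
        have "- Min A + Min A \<in> base A" using fin[OF A] unfolding base_def by (intro imageI) simp
        then show "0 \<in> base A" by simp
      qed
    qed (use F \<gamma> in auto)
    finally show ?thesis .
  qed
  have "0 \<le> K / \<gamma>" using \<open>K \<ge> 0\<close> \<gamma> by simp
  have "interaction U w (K + K / \<gamma>)"
  proof
    show "sum w F \<le> K + K / \<gamma>" if "finite F" "F \<subseteq> {A\<in>fin_sets. i \<in> A}" for F i
      using site[OF that] \<open>0 \<le> K / \<gamma>\<close> by linarith
    show "sum w F \<le> K + K / \<gamma>" if "finite F" "F \<subseteq> crossing a" for F a
      using cross[OF that] \<open>K \<ge> 0\<close> by linarith
  qed (fact loc transl bnd)+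
  then show thesis by (rule that)
qed

text \<open>The numerator and the normalising sum each change by a factor of at most
  \<open>exp e\<close>.\<close>

lemma softmax_bounds:
  fixes a b :: "'x \<Rightarrow> real"
  assumes "finite X" "x \<in> X" and ab: "\<And>x. x \<in> X \<Longrightarrow> \<bar>a x - b x\<bar> \<le> e"
  shows "exp (- a x) / (\<Sum>y\<in>X. exp (- a y)) \<le> exp (2 * e) * (exp (- b x) / (\<Sum>y\<in>X. exp (- b y)))"
    (is "?l / ?A \<le> _ * (?r / ?B)")
proof -
  have pos: "0 < ?A" "0 < ?B" using assms by (auto intro!: sum_pos)
  have "?l \<le> exp e * ?r" using ab[OF assms(2)] by (simp flip: exp_add)
  moreover have "?B \<le> exp e * ?A"
    unfolding sum_distrib_left using ab by (intro sum_mono) (force simp flip: exp_add)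
  ultimately have "?l * ?B \<le> (exp e * ?r) * (exp e * ?A)"
    using pos by (intro mult_mono) auto
  moreover have "exp (2 * e) = exp e * exp e" by (simp flip: exp_add)
  ultimately show ?thesis using pos by (simp only:) (simp add: field_simps)
qed

section \<open>Energies across cuts, partition sums and pressure\<close>

context interaction
begin

lemma D_nonneg: "0 \<le> D"
  using site[of "{}"] by simp

lemma finite_fin_sets_subset: "finite S \<Longrightarrow> finite {A\<in>fin_sets. A \<subseteq> S}"
  by (rule finite_subset[of _ "Pow S"]) auto

lemma energy_local: "(\<And>i. i \<in> S \<Longrightarrow> \<sigma> i = \<sigma>' i) \<Longrightarrow> energy U S \<sigma> = energy U S \<sigma>'"
  unfolding energy_def by (intro sum.cong refl local) auto

lemma energy_restrict: "energy U S (restrict \<sigma> S) = energy U S \<sigma>"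
  by (rule energy_local) simp

lemma energy_translate:
  notes uminus_add_conv_diff [simp del]
  shows "energy U ((+) i ` S) \<sigma> = energy U S (shift i \<sigma>)"
  unfolding energy_def
proof (rule sum.reindex_bij_witness[where i = "(`) ((+) i)" and j = "(`) ((+) (- i))"], goal_cases)
  case (5 A)
  then have "A = (+) i ` (+) (- i) ` A" by (simp add: image_image)
  then show ?case using 5 translate[of "(+) (- i) ` A" i \<sigma>] by simp
qed (auto simp: image_image image_subset_iff subset_eq)

lemma sum_crossing_le:
  assumes "finite F" "F \<subseteq> crossing a" "\<And>A. A \<in> F \<Longrightarrow> \<bar>f A\<bar> \<le> w A"
  shows "\<bar>\<Sum>A\<in>F. f A\<bar> \<le> D"
proof -
  have "\<bar>\<Sum>A\<in>F. f A\<bar> \<le> (\<Sum>A\<in>F. \<bar>f A\<bar>)" by (rule sum_abs)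
  also have "\<dots> \<le> sum w F" by (rule sum_mono) (rule assms(3))
  also have "\<dots> \<le> D" using assms by (intro cross)
  finally show ?thesis .
qed

lemma block_add: "block i (m + n) = block i m \<union> block (i + int m) n"
  by auto

text \<open>The sets inside the long block that fit into neither half cross the cut at
  \<open>i + int m\<close>.\<close>

lemma energy_block_add:
  "\<bar>energy U (block i (m + n)) \<sigma> - energy U (block i m) \<sigma> - energy U (block (i + int m) n) \<sigma>\<bar> \<le> D"
proof -
  let ?X = "{A\<in>fin_sets. A \<subseteq> block i (m + n)}"
  let ?Y = "{A\<in>fin_sets. A \<subseteq> block i m}" and ?Z = "{A\<in>fin_sets. A \<subseteq> block (i + int m) n}"
  have fin: "finite ?X" "finite ?Y" "finite ?Z" by (intro finite_fin_sets_subset; simp)+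
  have "?Y \<inter> ?Z = {}"
  proof safe
    fix A assume "A \<subseteq> block i m" "A \<subseteq> block (i + int m) n" "A \<in> fin_sets"
    moreover then obtain x where "x \<in> A" by (auto simp: fin_sets_def)
    ultimately have "x \<in> block i m" "x \<in> block (i + int m) n" by blast+
    then show "A \<in> {}" by simp
  qed
  then have "energy U (block i (m + n)) \<sigma> - energy U (block i m) \<sigma> - energy U (block (i + int m) n) \<sigma>
      = (\<Sum>A\<in>?X. U A \<sigma>) - (\<Sum>A\<in>?Y \<union> ?Z. U A \<sigma>)"
    using fin by (simp add: energy_def sum.union_disjoint)
  also have "\<dots> = (\<Sum>A\<in>?X - (?Y \<union> ?Z). U A \<sigma>)"
    using fin by (intro sum_diff[symmetric]) (auto simp: block_add)
  finally show ?thesis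
    using fin
  proof (simp only:, intro sum_crossing_le[where a = "i + int m"])
    show "?X - (?Y \<union> ?Z) \<subseteq> crossing (i + int m)"
    proof
      fix A assume A: "A \<in> ?X - (?Y \<union> ?Z)"
      then have "\<not> A \<subseteq> block (i + int m) n" "\<not> A \<subseteq> block i m" by auto
      then obtain x y where "x \<in> A" "x \<notin> block (i + int m) n" "y \<in> A" "y \<notin> block i m" by blast
      with A have "x \<in> A" "x \<le> i + int m" "y \<in> A" "i + int m < y" by fastforce+
      with A show "A \<in> crossing (i + int m)" by (auto simp: crossing_def)
    qed
  qed (auto intro: bound)
qed

text \<open>Only sets containing \<open>i\<close> notice the change, each by at most
  \<open>2 * w A\<close>.\<close>

lemma energy_fun_upd:
  assumes "finite S"
  shows "\<bar>energy U S (\<sigma>(i := b)) - energy U S \<sigma>\<bar> \<le> 2 * D"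
proof -
  let ?X = "{A\<in>fin_sets. A \<subseteq> S}" and ?Y = "{A\<in>fin_sets. A \<subseteq> S \<and> i \<in> A}"
  have fin: "finite ?X" "finite ?Y"
    using finite_fin_sets_subset[OF assms] by (auto elim: rev_finite_subset)
  have "energy U S (\<sigma>(i := b)) - energy U S \<sigma> = (\<Sum>A\<in>?X. U A (\<sigma>(i := b)) - U A \<sigma>)"
    by (simp add: energy_def sum_subtractf)
  also have "\<dots> = (\<Sum>A\<in>?Y. U A (\<sigma>(i := b)) - U A \<sigma>)"
  proof (rule sum.mono_neutral_right[OF fin(1)])
    have "U A (\<sigma>(i := b)) = U A \<sigma>" if "A \<in> ?X - ?Y" for A
      using that by (intro local) auto
    then show "\<forall>A\<in>?X - ?Y. U A (\<sigma>(i := b)) - U A \<sigma> = 0" by simp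
  qed auto
  finally have "\<bar>energy U S (\<sigma>(i := b)) - energy U S \<sigma>\<bar> \<le> (\<Sum>A\<in>?Y. \<bar>U A (\<sigma>(i := b)) - U A \<sigma>\<bar>)"
    by (simp only: sum_abs)
  also have "\<dots> \<le> (\<Sum>A\<in>?Y. 2 * w A)"
  proof (rule sum_mono)
    fix A assume "A \<in> ?Y"
    then show "\<bar>U A (\<sigma>(i := b)) - U A \<sigma>\<bar> \<le> 2 * w A"
      using bound[of A "\<sigma>(i := b)"] bound[of A \<sigma>] by auto
  qed
  also have "\<dots> = 2 * sum w ?Y" by (simp add: sum_distrib_left)
  also have "\<dots> \<le> 2 * D" using fin site[of ?Y i] by auto
  finally show ?thesis .
qed

lemma partition_sum_pos: "finite S \<Longrightarrow> 0 < partition_sum U S"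
  unfolding partition_sum_def by (intro sum_pos finite_PiE_UNIV) (auto simp: PiE_eq_empty_iff)

lemma partition_sum_translate: "partition_sum U ((+) i ` S) = partition_sum U S"
proof -
  have "partition_sum U ((+) i ` S)
      = (\<Sum>x\<in>((+) i ` S) \<rightarrow>\<^sub>E UNIV. exp (- energy U S (restrict (shift i x) S)))"
    by (simp add: partition_sum_def energy_translate energy_restrict)
  then show ?thesis
    by (simp add: sum_PiE_shift[where F = "\<lambda>x. exp (- energy U S x)"] partition_sum_def)
qed

lemma partition_sum_block: "partition_sum U (block i n) = partition_sum U (block 0 n)"
proof -
  have "block i n = (+) i ` block 0 n" by simp
  then show ?thesis by (simp only: partition_sum_translate)
qed

text \<open>The product of the two partition sums is the sum over words of the long block with the
  energy across the cut left out, and that energy is at most \<open>D\<close> in absolute value for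
  every word.\<close>

lemma partition_sum_add:
  "\<bar>ln (partition_sum U (block 0 (m + n))) - ln (partition_sum U (block 0 m))
      - ln (partition_sum U (block 0 n))\<bar> \<le> D"
proof -
  define Zm Zn Z where Z_defs: "Zm = partition_sum U (block 0 m)" "Zn = partition_sum U (block 0 n)"
    "Z = partition_sum U (block 0 (m + n))"
  have pos: "0 < Zm" "0 < Zn" "0 < Z" by (simp_all add: Z_defs partition_sum_pos)
  let ?S = "block 0 m" and ?T = "block (int m) n"
  let ?p = "\<lambda>x. exp (- energy U ?S (restrict x ?S)) * exp (- energy U ?T (restrict x ?T))"
  have un: "block 0 (m + n) = ?S \<union> ?T" by auto
  have "(\<Sum>x\<in>(?S \<union> ?T) \<rightarrow>\<^sub>E UNIV. ?p x) = partition_sum U ?S * partition_sum U ?T"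
    unfolding partition_sum_def
    by (rule sum_PiE_Un_prod[where F = "\<lambda>x. exp (- energy U ?S x)" and G = "\<lambda>x. exp (- energy U ?T x)"])
      auto
  then have prod: "(\<Sum>x\<in>(?S \<union> ?T) \<rightarrow>\<^sub>E UNIV. ?p x) = Zm * Zn"
    using partition_sum_block[of "int m" n] by (simp add: Z_defs)
  have e: "\<bar>energy U (?S \<union> ?T) x - energy U ?S x - energy U ?T x\<bar> \<le> D" for x
    using energy_block_add[of 0 m n x] unfolding un by simp
  have "exp (- energy U (?S \<union> ?T) x) \<le> exp D * ?p x" for x
    using e[of x] by (simp add: energy_restrict flip: exp_add)
  then have "Z \<le> exp D * (Zm * Zn)"
    unfolding Z_defs(3) un partition_sum_def prod[symmetric] sum_distrib_left by (intro sum_mono)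
  then have "ln Z \<le> ln (exp D * (Zm * Zn))" using pos by (intro iffD2[OF ln_le_cancel_iff]) auto
  then have upper: "ln Z \<le> D + ln Zm + ln Zn" using pos by (simp add: ln_mult)
  have "?p x \<le> exp D * exp (- energy U (?S \<union> ?T) x)" for x
    using e[of x] by (simp add: energy_restrict flip: exp_add)
  then have "Zm * Zn \<le> exp D * Z"
    unfolding Z_defs(3) un partition_sum_def prod[symmetric] sum_distrib_left by (intro sum_mono)
  then have "ln (Zm * Zn) \<le> ln (exp D * Z)" using pos by (intro iffD2[OF ln_le_cancel_iff]) auto
  then have "ln Zm + ln Zn \<le> D + ln Z" using pos by (simp add: ln_mult)
  with upper show ?thesis unfolding Z_defs by linarith
qed

text \<open>Near-additivity shows that the \<open>lim\<close> in \<open>pressure\<close> is a true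
  limit and that the error stays bounded as \<open>n\<close> grows; exponents can thus be traded for
  constants.\<close>

lemma pressure_bound:
  "\<bar>ln (partition_sum U (block i n)) - real n * pressure U\<bar> \<le> D"
proof -
  have "pressure U = lim (\<lambda>n. 1 / real n * ln (partition_sum U (block 0 n)))"
    unfolding pressure_def partition_sum_def energy_def by simp
  then show ?thesis
    unfolding partition_sum_block[of i]
    using almost_additive_limit[of "\<lambda>n. ln (partition_sum U (block 0 n))" D n] partition_sum_add
    by simp
qed

lemma interaction_double: "interaction (\<lambda>A \<sigma>. 2 * U A \<sigma>) (\<lambda>A. 2 * w A) (2 * D)"
proof
  show "sum (\<lambda>A. 2 * w A) F \<le> 2 * D" if "finite F" "F \<subseteq> {A\<in>fin_sets. i \<in> A}" for F i
    using site[OF that] by (simp flip: sum_distrib_left)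
  show "sum (\<lambda>A. 2 * w A) F \<le> 2 * D" if "finite F" "F \<subseteq> crossing a" for F a
    using cross[OF that] by (simp flip: sum_distrib_left)
qed (auto simp: translate abs_mult bound intro: local)

section \<open>Free-boundary weights, their squares, and comparison with Gibbs weights\<close>

lemma word_weight_nonneg: "finite S \<Longrightarrow> 0 \<le> word_weight U S x"
  unfolding word_weight_def using partition_sum_pos[of S] by simp

lemma sum_word_weight: "finite S \<Longrightarrow> (\<Sum>x\<in>S \<rightarrow>\<^sub>E UNIV. word_weight U S x) = 1"
  unfolding word_weight_def sum_divide_distrib[symmetric] using partition_sum_pos[of S]
  by (simp add: partition_sum_def)

text \<open>The probability that two independent words coincide is \<open>z2 / z\<^sup>2\<close>,
  with \<open>z2\<close> the partition sum of twice the interaction; this is where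
  \<open>match_rate\<close> comes from. The error \<open>4 * D\<close> is \<open>2 * D\<close> for
  \<open>z2\<close> plus twice \<open>D\<close> for \<open>z\<close>.\<close>

lemma sum_sq_word_weight:
  defines "\<alpha> \<equiv> match_rate U"
  shows "exp (- 4 * D) * exp (- 2 * \<alpha> * real n) \<le> (\<Sum>x\<in>block i n \<rightarrow>\<^sub>E UNIV. (word_weight U (block i n) x)\<^sup>2)"
    and "(\<Sum>x\<in>block i n \<rightarrow>\<^sub>E UNIV. (word_weight U (block i n) x)\<^sup>2) \<le> exp (4 * D) * exp (- 2 * \<alpha> * real n)"
proof -
  let ?V = "\<lambda>A \<sigma>. 2 * U A \<sigma>"
  interpret double: interaction ?V "\<lambda>A. 2 * w A" "2 * D" by (rule interaction_double)
  define z z2 where "z = partition_sum U (block i n)" and "z2 = partition_sum ?V (block i n)"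
  have pos: "0 < z" "0 < z2"
    by (simp_all add: z_def z2_def partition_sum_pos double.partition_sum_pos)
  have "energy ?V S x = 2 * energy U S x" for S x
    by (simp add: energy_def sum_distrib_left)
  then have sq: "(\<Sum>x\<in>block i n \<rightarrow>\<^sub>E UNIV. (word_weight U (block i n) x)\<^sup>2) = z2 / z\<^sup>2"
    by (simp add: word_weight_def power_divide z_def z2_def partition_sum_def[of ?V]
        exp_double[symmetric] flip: sum_divide_distrib)
  have "\<bar>ln z - real n * pressure U\<bar> \<le> D" "\<bar>ln z2 - real n * pressure ?V\<bar> \<le> 2 * D"
    unfolding z_def z2_def by (rule pressure_bound double.pressure_bound)+
  moreover have "2 * \<alpha> * real n = 2 * (real n * pressure U) - real n * pressure ?V"
    by (simp add: \<alpha>_def match_rate_def algebra_simps)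
  ultimately have *: "\<bar>ln z2 - 2 * ln z + 2 * \<alpha> * real n\<bar> \<le> 4 * D" by linarith
  have eq: "z2 / z\<^sup>2 = exp (ln z2 - 2 * ln z)"
    using pos by (simp add: exp_diff exp_double)
  show "exp (- 4 * D) * exp (- 2 * \<alpha> * real n) \<le> (\<Sum>x\<in>block i n \<rightarrow>\<^sub>E UNIV. (word_weight U (block i n) x)\<^sup>2)"
    unfolding sq eq exp_add[symmetric] using * by (simp add: abs_le_iff)
  show "(\<Sum>x\<in>block i n \<rightarrow>\<^sub>E UNIV. (word_weight U (block i n) x)\<^sup>2) \<le> exp (4 * D) * exp (- 2 * \<alpha> * real n)"
    unfolding sq eq exp_add[symmetric] using * by (simp add: abs_le_iff)
qed

text \<open>Changing one letter of a word costs a bounded factor, and the \<open>n\<close> changed words are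
  distinct, so no word of length \<open>n\<close> has weight above a constant times \<open>1 / n\<close>.\<close>

lemma word_weight_le:
  assumes "CARD('a) \<ge> 2" "x \<in> block i n \<rightarrow>\<^sub>E UNIV"
  shows "real n * word_weight U (block i n) x \<le> exp (2 * D)"
proof -
  let ?S = "block i n"
  have "\<exists>b. b \<noteq> a" for a :: 'a
  proof (rule ccontr)
    assume "\<not> ?thesis"
    then have "(UNIV :: 'a set) = {a}" by auto
    then have "CARD('a) = 1" by (metis card_1_singleton_iff One_nat_def)
    with assms(1) show False by simp
  qed
  then obtain f :: "'a \<Rightarrow> 'a" where f: "f a \<noteq> a" for a by metis
  define y where "y j = x(j := f (x j))" for j
  have "inj_on y ?S" by (rule inj_onI) (metis y_def f fun_upd_same fun_upd_other)
  have "exp (- 2 * D) * word_weight U ?S x \<le> word_weight U ?S (y j)" for j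
  proof -
    have "exp (- 2 * D) * exp (- energy U ?S x) \<le> exp (- energy U ?S (y j))"
      using energy_fun_upd[of ?S x j "f (x j)"] by (simp add: y_def flip: exp_add)
    from divide_right_mono[OF this, of "partition_sum U ?S"] partition_sum_pos[of ?S]
    show ?thesis by (simp add: word_weight_def)
  qed
  then have "(\<Sum>j\<in>?S. exp (- 2 * D) * word_weight U ?S x) \<le> (\<Sum>j\<in>?S. word_weight U ?S (y j))"
    by (intro sum_mono)
  also have "\<dots> = (\<Sum>z\<in>y ` ?S. word_weight U ?S z)"
    by (simp add: sum.reindex[OF \<open>inj_on y ?S\<close>])
  also have "\<dots> \<le> (\<Sum>z\<in>?S \<rightarrow>\<^sub>E UNIV. word_weight U ?S z)"
    using assms(2) by (intro sum_mono2 finite_PiE_UNIV word_weight_nonneg)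
      (auto simp: y_def PiE_def extensional_def)
  also have "\<dots> = 1" by (rule sum_word_weight) simp
  finally show ?thesis by (simp add: exp_minus field_simps)
qed

text \<open>The sum of squares is at most the largest weight, hence at most
  \<open>exp (2 * D) / n\<close>, whereas a rate that is not positive would keep it above
  \<open>exp (- 4 * D)\<close>. Any \<open>n\<close> beyond \<open>exp (6 * D)\<close> separates the
  two.\<close>

lemma match_rate_pos:
  assumes "CARD('a) \<ge> 2"
  shows "match_rate U > 0"
proof (rule ccontr)
  assume "\<not> ?thesis"
  then have \<alpha>: "match_rate U \<le> 0" by simp
  obtain n :: nat where n: "exp (6 * D) < real n" using reals_Archimedean2 by blast
  then have "0 < real n" using exp_gt_zero[of "6 * D"] by linarith
  let ?S = "block 0 n"
  have "exp (- 4 * D) * 1 \<le> exp (- 4 * D) * exp (- 2 * match_rate U * real n)"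
    using \<alpha> by (intro mult_left_mono) (auto simp: mult_nonpos_nonneg)
  also have "\<dots> \<le> (\<Sum>x\<in>?S \<rightarrow>\<^sub>E UNIV. (word_weight U ?S x)\<^sup>2)" by (rule sum_sq_word_weight)
  also have "\<dots> \<le> (\<Sum>x\<in>?S \<rightarrow>\<^sub>E UNIV. exp (2 * D) / real n * word_weight U ?S x)"
  proof (rule sum_mono)
    fix x :: "int \<Rightarrow> 'a" assume "x \<in> ?S \<rightarrow>\<^sub>E UNIV"
    then have "word_weight U ?S x \<le> exp (2 * D) / real n"
      using word_weight_le[OF assms, of x 0 n] \<open>0 < real n\<close> by (simp add: field_simps)
    then show "(word_weight U ?S x)\<^sup>2 \<le> exp (2 * D) / real n * word_weight U ?S x"
      unfolding power2_eq_square by (intro mult_right_mono word_weight_nonneg) auto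
  qed
  also have "\<dots> = exp (2 * D) / real n"
    unfolding sum_distrib_left[symmetric] using sum_word_weight[of ?S] by simp
  finally have "exp (- 4 * D) * real n \<le> exp (2 * D)"
    using \<open>0 < real n\<close> by (simp add: field_simps)
  moreover have "exp (- 4 * D) * exp (6 * D) < exp (- 4 * D) * real n"
    using n by (intro mult_strict_left_mono) auto
  ultimately show False by (simp flip: exp_add)
qed

text \<open>Sets inside the block give exactly its energy; every other set meeting it crosses one of
  the two ends, which costs \<open>D\<close> each.\<close>

lemma hamiltonian_energy:
  assumes "n \<ge> 1"
  shows "\<bar>hamiltonian U (block i n) \<zeta> \<eta> - energy U (block i n) \<eta>\<bar> \<le> 2 * D"
proof -
  let ?S = "block i n"
  let ?f = "\<lambda>A. U A (override_on \<zeta> \<eta> ?S)"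
  let ?X = "{A\<in>fin_sets. A \<subseteq> ?S}" and ?Y = "{A\<in>fin_sets. A \<inter> ?S \<noteq> {} \<and> \<not> A \<subseteq> ?S}"
  have un: "{A\<in>fin_sets. A \<inter> ?S \<noteq> {}} = ?X \<union> ?Y" by (auto simp: fin_sets_def)
  have "?Y \<subseteq> crossing i \<union> crossing (i + int n)"
    by (auto simp: crossing_def subset_iff) (metis linorder_not_less order_less_le_trans zless_add1_eq add.commute order_less_imp_le zle_add1_eq_le)+
  then have le: "sum w F \<le> 2 * D" if F: "finite F" "F \<subseteq> ?Y" for F
  proof -
    have "sum w F = sum w (F \<inter> crossing i) + sum w (F - crossing i)"
      using F by (subst sum.Int_Diff) auto
    also have "\<dots> \<le> D + D"
      using F \<open>?Y \<subseteq> _\<close> by (intro add_mono cross[where a = i] cross[where a = "i + int n"]) auto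
    finally show ?thesis by simp
  qed
  have sums: "(\<Sum>A\<in>F. norm (?f A)) \<le> 2 * D" if F: "finite F" "F \<subseteq> ?Y" for F
  proof -
    have "(\<Sum>A\<in>F. norm (?f A)) \<le> sum w F" using F by (intro sum_mono) (auto intro: bound)
    then show ?thesis using le[OF F] by linarith
  qed
  \<comment> \<open>Absolute summability lets the Hamiltonian split and rules out the default value
    0 of \<open>infsum\<close>.\<close>
  have abs: "(\<lambda>A. norm (?f A)) summable_on ?Y"
  proof (rule nonneg_bdd_above_summable_on)
    show "bdd_above (sum (\<lambda>A. norm (?f A)) ` {F. F \<subseteq> ?Y \<and> finite F})"
      by (rule bdd_aboveI2[of _ _ "2 * D"]) (use sums in blast)
  qed simp
  have "hamiltonian U ?S \<zeta> \<eta> = infsum ?f ?X + infsum ?f ?Y"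
    unfolding hamiltonian_def un
    by (rule infsum_Un_disjoint) (auto intro: abs_summable_summable[OF abs] finite_fin_sets_subset)
  also have "infsum ?f ?X = energy U ?S \<eta>"
    unfolding energy_def infsum_finite[OF finite_fin_sets_subset[OF finite_atLeastAtMost_int]]
    by (intro sum.cong refl local) (auto simp: override_on_def)
  finally have "\<bar>hamiltonian U ?S \<zeta> \<eta> - energy U ?S \<eta>\<bar> = norm (infsum ?f ?Y)" by simp
  also have "\<dots> \<le> infsum (\<lambda>A. norm (?f A)) ?Y" by (rule norm_infsum_bound[OF abs])
  also have "\<dots> \<le> 2 * D" by (rule infsum_le_finite_sums[OF abs sums])
  finally show ?thesis .
qed

text \<open>\<open>softmax_bounds\<close> in both directions with error \<open>2 * D\<close>. The
  bounds do not involve \<open>\<zeta>\<close>.\<close>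

lemma gibbs_weight_bounds:
  assumes "n \<ge> 1" "x \<in> block i n \<rightarrow>\<^sub>E UNIV"
  shows "gibbs_weight U (block i n) \<zeta> x \<le> exp (4 * D) * word_weight U (block i n) x"
    and "exp (- 4 * D) * word_weight U (block i n) x \<le> gibbs_weight U (block i n) \<zeta> x"
proof -
  let ?S = "block i n"
  have fin: "finite (?S \<rightarrow>\<^sub>E (UNIV :: 'a set))" by (intro finite_PiE_UNIV) simp
  have h: "\<bar>hamiltonian U ?S \<zeta> y - energy U ?S y\<bar> \<le> 2 * D"
    "\<bar>energy U ?S y - hamiltonian U ?S \<zeta> y\<bar> \<le> 2 * D" for y
    using hamiltonian_energy[OF assms(1), of i \<zeta> y] by (auto simp: abs_minus_commute)
  show "gibbs_weight U (block i n) \<zeta> x \<le> exp (4 * D) * word_weight U (block i n) x"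
    using softmax_bounds[OF fin assms(2) h(1)]
    by (simp add: gibbs_weight_def word_weight_def partition_sum_def)
  have "word_weight U ?S x \<le> exp (4 * D) * gibbs_weight U ?S \<zeta> x"
    using softmax_bounds[OF fin assms(2) h(2)]
    by (simp add: gibbs_weight_def word_weight_def partition_sum_def)
  from mult_left_mono[OF this, of "exp (- 4 * D)"]
  show "exp (- 4 * D) * word_weight U ?S x \<le> gibbs_weight U ?S \<zeta> x"
    by (simp flip: exp_add mult.assoc)
qed

end

section \<open>Matches under a Gibbs measure\<close>

lemma cylinder_in_coord_algebra:
  fixes x :: "int \<Rightarrow> 'a::finite"
  shows "finite S \<Longrightarrow> {\<sigma>. restrict \<sigma> S = x} \<in> sets (coord_algebra S)"
  by (rule coord_algebra_finiteI) (auto cong: restrict_cong)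

definition match :: "nat \<Rightarrow> int \<Rightarrow> int \<Rightarrow> (int \<Rightarrow> 'a) set" where
  "match k i j = {\<sigma>. \<forall>l\<in>{1..int k}. \<sigma> (i + l) = \<sigma> (j + l)}"

text \<open>The bounds \<open>a \<le> i\<close>, \<open>i < j\<close> and
  \<open>j + k \<le> a + L\<close> keep both words inside \<open>block a L\<close>; the upper bound
  on \<open>i\<close> only makes the union finite.\<close>

definition has_match :: "nat \<Rightarrow> int \<Rightarrow> nat \<Rightarrow> (int \<Rightarrow> 'a) set" where
  "has_match k a L = (\<Union>i\<in>{a..a + int L}. \<Union>j\<in>{i + 1..a + int L - int k}. match k i j)"

lemma match_commute: "match k i j = match k j i"
  by (auto simp: match_def)

lemma match_in_coord_algebra:
  assumes "block i k \<union> block j k \<subseteq> V"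
  shows "(match k i j :: (int \<Rightarrow> 'a::finite) set) \<in> sets (coord_algebra V)"
proof -
  have "(match k i j :: (int \<Rightarrow> 'a) set) \<in> sets (coord_algebra (block i k \<union> block j k))"
  proof (rule coord_algebra_finiteI)
    fix \<sigma> \<sigma>' :: "int \<Rightarrow> 'a"
    assume \<sigma>: "\<sigma> \<in> match k i j" and eq: "\<And>l. l \<in> block i k \<union> block j k \<Longrightarrow> \<sigma> l = \<sigma>' l"
    have "\<sigma>' (i + l) = \<sigma>' (j + l)" if "l \<in> {1..int k}" for l
      using \<sigma> eq[of "i + l"] eq[of "j + l"] that by (simp add: match_def)
    then show "\<sigma>' \<in> match k i j" by (simp add: match_def)
  qed simp
  then show ?thesis using coord_algebra_mono[OF assms] by blast
qed

lemma has_match_in_coord_algebra: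
  "(has_match k a L :: (int \<Rightarrow> 'a::finite) set) \<in> sets (coord_algebra (block a L))"
  unfolding has_match_def by (intro sets.finite_UN match_in_coord_algebra) auto

locale gibbs = interaction U w D
  for U :: "int set \<Rightarrow> (int \<Rightarrow> 'a::finite) \<Rightarrow> real" and w D +
  fixes P :: "(int \<Rightarrow> 'a) measure"
  assumes card_ge_2: "CARD('a) \<ge> 2" and gibbs_measure: "gibbs_measure U P"
begin

definition \<alpha> :: real where "\<alpha> = match_rate U"

lemma \<alpha>_pos: "0 < \<alpha>"
  unfolding \<alpha>_def using card_ge_2 by (rule match_rate_pos)

sublocale prob_space P
  using gibbs_measure by (simp add: gibbs_measure_def)

lemma space_P [simp]: "space P = UNIV"
proof -
  have "space P = space (config_space :: (int \<Rightarrow> 'a) measure)"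
    using gibbs_measure by (intro sets_eq_imp_space_eq) (simp add: gibbs_measure_def)
  then show ?thesis by (simp add: config_space_def space_PiM)
qed

lemma events_coord_algebra [intro]: "X \<in> sets (coord_algebra V) \<Longrightarrow> X \<in> events"
  using gibbs_measure coord_algebra_subset_config_space unfolding gibbs_measure_def by blast

lemma match_events [intro]: "match k i j \<in> events"
  by (rule events_coord_algebra[OF match_in_coord_algebra[OF order_refl]])

text \<open>The conditional probability of the word given the outside is integrated over
  \<open>R\<close>; it is a Gibbs weight almost everywhere, and that lies between multiples of the
  free-boundary weight.\<close>

lemma prob_block:
  assumes n: "n \<ge> 1" and x: "x \<in> block i n \<rightarrow>\<^sub>E UNIV" and R: "R \<in> sets (coord_algebra (- block i n))"
  shows "prob ({\<sigma>. restrict \<sigma> (block i n) = x} \<inter> R) \<le> exp (4 * D) * word_weight U (block i n) x * prob R"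
    and "exp (- 4 * D) * word_weight U (block i n) x * prob R \<le> prob ({\<sigma>. restrict \<sigma> (block i n) = x} \<inter> R)"
proof -
  let ?S = "block i n"
  let ?F = "coord_algebra (- ?S) :: (int \<Rightarrow> 'a) measure"
  let ?E = "{\<sigma>. restrict \<sigma> ?S = x}"
  let ?f = "indicator ?E :: (int \<Rightarrow> 'a) \<Rightarrow> real"
  interpret F: finite_measure_subalgebra P ?F
    by unfold_locales (auto simp: subalgebra_def)
  have E: "?E \<in> events" by (rule events_coord_algebra[OF cylinder_in_coord_algebra]) simp
  have R': "R \<in> events" using R by auto
  have f: "integrable P ?f" using E by (simp add: less_top[symmetric])
  have ce: "set_integrable P R (real_cond_exp P ?F ?f)"
    unfolding set_integrable_def using R' F.real_cond_exp_int(1)[OF f]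
    by (rule integrable_mult_indicator)
  have const: "set_integrable P R (\<lambda>_. c)" "(LINT \<zeta>:R|P. c) = c * prob R" for c :: real
    using R' by (auto simp: set_integrable_def set_lebesgue_integral_def less_top[symmetric])
  have "?S \<in> fin_sets" using n by (simp add: fin_sets_def)
  with x gibbs_measure have AE: "AE \<zeta> in P. real_cond_exp P ?F ?f \<zeta> = gibbs_weight U ?S \<zeta> x"
    unfolding gibbs_measure_def by blast
  have "prob (?E \<inter> R) = (LINT \<zeta>:R|P. ?f \<zeta>)"
    using E R' by (simp add: set_lebesgue_integral_def indicator_inter_arith[symmetric] Int_commute)
  also have "\<dots> = (LINT \<zeta>:R|P. real_cond_exp P ?F ?f \<zeta>)"
    by (rule F.real_cond_exp_intA[OF f R])
  finally have eq: "prob (?E \<inter> R) = (LINT \<zeta>:R|P. real_cond_exp P ?F ?f \<zeta>)" .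
  show "prob (?E \<inter> R) \<le> exp (4 * D) * word_weight U ?S x * prob R"
    unfolding eq const(2)[symmetric]
  proof (rule set_integral_mono_AE[OF ce const(1)])
    show "AE \<zeta>\<in>R in P. real_cond_exp P ?F ?f \<zeta> \<le> exp (4 * D) * word_weight U ?S x"
      using AE by eventually_elim (simp only: gibbs_weight_bounds[OF n x] simp_thms)
  qed
  show "exp (- 4 * D) * word_weight U ?S x * prob R \<le> prob (?E \<inter> R)"
    unfolding eq const(2)[symmetric]
  proof (rule set_integral_mono_AE[OF const(1) ce])
    show "AE \<zeta>\<in>R in P. exp (- 4 * D) * word_weight U ?S x \<le> real_cond_exp P ?F ?f \<zeta>"
      using AE by eventually_elim (simp only: gibbs_weight_bounds[OF n x] simp_thms)
  qed
qed

text \<open>Domination of word probabilities, uniformly over outside events, by a weight with small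
  sum of squares. The weight stays existential since only this sum enters Cauchy--Schwarz: it is a
  multiple of \<open>word_weight\<close> for a block and a product for a union.\<close>

definition good :: "real \<Rightarrow> int set \<Rightarrow> bool" where
  "good c S \<longleftrightarrow> finite S \<and> (\<exists>h. (\<forall>x. 0 \<le> h x) \<and>
     (\<forall>x\<in>S \<rightarrow>\<^sub>E UNIV. \<forall>R\<in>sets (coord_algebra (- S)).
        prob ({\<sigma>. restrict \<sigma> S = x} \<inter> R) \<le> h x * prob R) \<and>
     (\<Sum>x\<in>S \<rightarrow>\<^sub>E UNIV. (h x)\<^sup>2) \<le> exp c * exp (- 2 * \<alpha> * card S))"

lemma good_mono: "good c S \<Longrightarrow> c \<le> c' \<Longrightarrow> good c' S"
  unfolding good_def by (meson exp_ge_zero exp_le_cancel_iff mult_right_mono order_trans)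

text \<open>The exponent collects \<open>8 * D\<close> from squaring the factor
  \<open>exp (4 * D)\<close> in \<open>prob_block\<close> and \<open>4 * D\<close> from
  \<open>sum_sq_word_weight\<close>.\<close>

lemma good_block:
  assumes "n \<ge> 1"
  shows "good (12 * D) (block i n)"
proof -
  let ?h = "\<lambda>x. exp (4 * D) * word_weight U (block i n) x"
  have "(\<Sum>x\<in>block i n \<rightarrow>\<^sub>E UNIV. (?h x)\<^sup>2)
      = (exp (4 * D))\<^sup>2 * (\<Sum>x\<in>block i n \<rightarrow>\<^sub>E UNIV. (word_weight U (block i n) x)\<^sup>2)"
    by (simp add: power_mult_distrib sum_distrib_left)
  also have "\<dots> \<le> (exp (4 * D))\<^sup>2 * (exp (4 * D) * exp (- 2 * \<alpha> * real n))"
    unfolding \<alpha>_def by (intro mult_left_mono sum_sq_word_weight) simp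
  also have "\<dots> = exp (12 * D) * exp (- 2 * \<alpha> * card (block i n))"
    by (simp add: power2_eq_square flip: exp_add mult.assoc)
  finally show ?thesis
    unfolding good_def using prob_block(1)[OF assms]
    by (intro conjI exI[of _ ?h]) (auto intro!: mult_nonneg_nonneg word_weight_nonneg)
qed

text \<open>The word on \<open>T\<close> together with \<open>R\<close> is an event outside
  \<open>S\<close>, so the two words are peeled off one after the other and the dominating weights
  multiply.\<close>

lemma good_Un:
  assumes "good c S" "good c' T" and disj: "S \<inter> T = {}"
  shows "good (c + c') (S \<union> T)"
proof -
  obtain h where h: "\<And>x. 0 \<le> h x"
      "\<And>x R. x \<in> S \<rightarrow>\<^sub>E UNIV \<Longrightarrow> R \<in> sets (coord_algebra (- S)) \<Longrightarrow>
        prob ({\<sigma>. restrict \<sigma> S = x} \<inter> R) \<le> h x * prob R"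
      "(\<Sum>x\<in>S \<rightarrow>\<^sub>E UNIV. (h x)\<^sup>2) \<le> exp c * exp (- 2 * \<alpha> * card S)"
    and fin: "finite S" using assms(1) unfolding good_def by blast
  obtain h' where h': "\<And>x. 0 \<le> h' x"
      "\<And>x R. x \<in> T \<rightarrow>\<^sub>E UNIV \<Longrightarrow> R \<in> sets (coord_algebra (- T)) \<Longrightarrow>
        prob ({\<sigma>. restrict \<sigma> T = x} \<inter> R) \<le> h' x * prob R"
      "(\<Sum>x\<in>T \<rightarrow>\<^sub>E UNIV. (h' x)\<^sup>2) \<le> exp c' * exp (- 2 * \<alpha> * card T)"
    and fin': "finite T" using assms(2) unfolding good_def by blast
  let ?g = "\<lambda>x. h (restrict x S) * h' (restrict x T)"
  have "prob ({\<sigma>. restrict \<sigma> (S \<union> T) = x} \<inter> R) \<le> ?g x * prob R"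
    if x: "x \<in> (S \<union> T) \<rightarrow>\<^sub>E UNIV" and R: "R \<in> sets (coord_algebra (- (S \<union> T)))" for x R
  proof -
    let ?A = "{\<sigma>. restrict \<sigma> S = restrict x S}" and ?B = "{\<sigma>. restrict \<sigma> T = restrict x T}"
    have eq: "{\<sigma>. restrict \<sigma> (S \<union> T) = x} \<inter> R = ?A \<inter> (?B \<inter> R)"
      using x by (auto simp: fun_eq_iff restrict_def PiE_def extensional_def)
    have "?B \<in> sets (coord_algebra (- S))"
      using cylinder_in_coord_algebra[OF fin'] coord_algebra_mono[of T "- S"] disj by blast
    moreover have R1: "R \<in> sets (coord_algebra (- S))" "R \<in> sets (coord_algebra (- T))"
      using R coord_algebra_mono[of "- (S \<union> T)"] by blast+
    ultimately have "prob (?A \<inter> (?B \<inter> R)) \<le> h (restrict x S) * prob (?B \<inter> R)"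
      by (intro h sets.Int) auto
    also have "\<dots> \<le> h (restrict x S) * (h' (restrict x T) * prob R)"
      using R1 by (intro mult_left_mono h h') auto
    finally show ?thesis by (simp add: eq mult.assoc)
  qed
  moreover have "(\<Sum>x\<in>(S \<union> T) \<rightarrow>\<^sub>E UNIV. (?g x)\<^sup>2) \<le> exp (c + c') * exp (- 2 * \<alpha> * card (S \<union> T))"
  proof -
    have "(\<Sum>x\<in>(S \<union> T) \<rightarrow>\<^sub>E UNIV. (?g x)\<^sup>2)
        = (\<Sum>x\<in>S \<rightarrow>\<^sub>E UNIV. (h x)\<^sup>2) * (\<Sum>x\<in>T \<rightarrow>\<^sub>E UNIV. (h' x)\<^sup>2)"
      unfolding power_mult_distrib
      by (rule sum_PiE_Un_prod[where F = "\<lambda>x. (h x)\<^sup>2" and G = "\<lambda>x. (h' x)\<^sup>2", OF disj])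
    also have "\<dots> \<le> (exp c * exp (- 2 * \<alpha> * card S)) * (exp c' * exp (- 2 * \<alpha> * card T))"
      by (intro mult_mono h h' sum_nonneg) auto
    also have "\<dots> = exp (c + c') * exp (- 2 * \<alpha> * card (S \<union> T))"
      using fin fin' disj by (simp add: card_Un_disjoint algebra_simps flip: exp_add)
    finally show ?thesis .
  qed
  ultimately show ?thesis
    unfolding good_def using fin fin' h(1) h'(1) by (intro conjI exI[of _ ?g]) auto
qed

text \<open>The only correlation estimate needed: whatever the overlaps, a family of matches makes the
  letters on one set of sites and the letters on another set of sites determine each other, and
  Cauchy--Schwarz then decouples the two sets.\<close>

lemma prob_determined:
  assumes S: "good c S" and T: "good c T" and disj: "S \<inter> T = {}"
    and R: "R \<in> sets (coord_algebra (- (S \<union> T)))"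
    and det: "\<And>\<sigma> \<sigma>'. \<sigma> \<in> E \<Longrightarrow> \<sigma>' \<in> E \<Longrightarrow> (\<forall>i\<in>S. \<sigma> i = \<sigma>' i) \<longleftrightarrow> (\<forall>i\<in>T. \<sigma> i = \<sigma>' i)"
  shows "prob (E \<inter> R) \<le> exp c * exp (- \<alpha> * (real (card S) + real (card T))) * prob R"
proof -
  obtain h where h: "\<And>x. 0 \<le> h x"
      "\<And>x R. x \<in> S \<rightarrow>\<^sub>E UNIV \<Longrightarrow> R \<in> sets (coord_algebra (- S)) \<Longrightarrow>
        prob ({\<sigma>. restrict \<sigma> S = x} \<inter> R) \<le> h x * prob R"
      "(\<Sum>x\<in>S \<rightarrow>\<^sub>E UNIV. (h x)\<^sup>2) \<le> exp c * exp (- 2 * \<alpha> * card S)"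
    and fin: "finite S" using S unfolding good_def by blast
  obtain h' where h': "\<And>x. 0 \<le> h' x"
      "\<And>x R. x \<in> T \<rightarrow>\<^sub>E UNIV \<Longrightarrow> R \<in> sets (coord_algebra (- T)) \<Longrightarrow>
        prob ({\<sigma>. restrict \<sigma> T = x} \<inter> R) \<le> h' x * prob R"
      "(\<Sum>x\<in>T \<rightarrow>\<^sub>E UNIV. (h' x)\<^sup>2) \<le> exp c * exp (- 2 * \<alpha> * card T)"
    and fin': "finite T" using T unfolding good_def by blast
  have restrict_eq: "restrict \<sigma> V = restrict \<sigma>' V \<longleftrightarrow> (\<forall>i\<in>V. \<sigma> i = \<sigma>' i)"
    for \<sigma> \<sigma>' :: "int \<Rightarrow> 'a" and V by (auto simp: fun_eq_iff restrict_def)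
  define X where "X = (\<lambda>\<sigma>. restrict \<sigma> S) ` E"
  have "X \<subseteq> S \<rightarrow>\<^sub>E UNIV" by (auto simp: X_def)
  then have finX: "finite X" using finite_PiE_UNIV[OF fin] by (rule finite_subset)
  have "\<forall>x\<in>X. \<exists>\<sigma>\<in>E. restrict \<sigma> S = x" by (auto simp: X_def)
  \<comment> \<open>By \<open>det\<close> the word of \<open>s x\<close> on \<open>T\<close> does
    not depend on the representative chosen. The converse direction of \<open>det\<close> makes
    \<open>\<phi>\<close> injective.\<close>
  then obtain s where s: "\<And>x. x \<in> X \<Longrightarrow> s x \<in> E" "\<And>x. x \<in> X \<Longrightarrow> restrict (s x) S = x" by metis
  define \<phi> where "\<phi> x = restrict (s x) T" for x
  have "inj_on \<phi> X"
  proof (rule inj_onI)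
    fix x y assume "x \<in> X" "y \<in> X" "\<phi> x = \<phi> y"
    then show "x = y" using det[of "s x" "s y"] s unfolding \<phi>_def restrict_eq[symmetric] by metis
  qed
  let ?C = "\<lambda>x. {\<sigma>. restrict \<sigma> S = x} \<inter> ({\<sigma>. restrict \<sigma> T = \<phi> x} \<inter> R)"
  have cyl: "{\<sigma>. restrict \<sigma> T = y} \<in> sets (coord_algebra (- S))" for y :: "int \<Rightarrow> 'a"
    using cylinder_in_coord_algebra[OF fin'] coord_algebra_mono[of T "- S"] disj by blast
  have R1: "R \<in> sets (coord_algebra (- S))" "R \<in> sets (coord_algebra (- T))"
    using R coord_algebra_mono[of "- (S \<union> T)"] by blast+
  have "E \<inter> R \<subseteq> (\<Union>x\<in>X. ?C x)"
  proof
    fix \<sigma> assume \<sigma>: "\<sigma> \<in> E \<inter> R"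
    then have x: "restrict \<sigma> S \<in> X" by (simp add: X_def)
    then have "restrict \<sigma> T = \<phi> (restrict \<sigma> S)"
      using det[of \<sigma> "s (restrict \<sigma> S)"] s \<sigma> unfolding \<phi>_def restrict_eq[symmetric] by auto
    then show "\<sigma> \<in> (\<Union>x\<in>X. ?C x)" using \<sigma> x by blast
  qed
  moreover have ev: "?C x \<in> events" for x
    using cylinder_in_coord_algebra[OF fin] cyl R1 by (intro sets.Int) auto
  ultimately have "prob (E \<inter> R) \<le> prob (\<Union>x\<in>X. ?C x)"
    using finX by (intro finite_measure_mono sets.finite_UN) auto
  also have "\<dots> \<le> (\<Sum>x\<in>X. prob (?C x))"
    using finX ev by (intro measure_UNION_le) auto
  also have "\<dots> \<le> (\<Sum>x\<in>X. h x * h' (\<phi> x) * prob R)"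
  proof (rule sum_mono)
    fix x assume x: "x \<in> X"
    have "prob (?C x) \<le> h x * prob ({\<sigma>. restrict \<sigma> T = \<phi> x} \<inter> R)"
      using x \<open>X \<subseteq> _\<close> cyl R1 by (intro h sets.Int) auto
    also have "\<dots> \<le> h x * (h' (\<phi> x) * prob R)"
      using R1 by (intro mult_left_mono h h') (auto simp: \<phi>_def)
    finally show "prob (?C x) \<le> h x * h' (\<phi> x) * prob R" by (simp add: mult.assoc)
  qed
  also have "\<dots> = (\<Sum>x\<in>X. h x * h' (\<phi> x)) * prob R" by (simp add: sum_distrib_right)
  also have "\<dots> \<le> exp c * exp (- \<alpha> * (real (card S) + real (card T))) * prob R"
  proof (rule mult_right_mono)
    \<comment> \<open>Injectivity of \<open>\<phi>\<close> turns the last factor into a sum over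
      distinct words on \<open>T\<close>, so both factors are bounded by the full sums of
      squares.\<close>
    have "(\<Sum>x\<in>X. h x * h' (\<phi> x))\<^sup>2 \<le> (\<Sum>x\<in>X. (h x)\<^sup>2) * (\<Sum>x\<in>X. (h' (\<phi> x))\<^sup>2)"
      by (rule Cauchy_Schwarz_ineq_sum)
    also have "(\<Sum>x\<in>X. (h' (\<phi> x))\<^sup>2) = (\<Sum>y\<in>\<phi> ` X. (h' y)\<^sup>2)"
      by (simp add: sum.reindex[OF \<open>inj_on \<phi> X\<close>])
    also have "(\<Sum>x\<in>X. (h x)\<^sup>2) * (\<Sum>y\<in>\<phi> ` X. (h' y)\<^sup>2)
        \<le> (\<Sum>x\<in>S \<rightarrow>\<^sub>E UNIV. (h x)\<^sup>2) * (\<Sum>y\<in>T \<rightarrow>\<^sub>E UNIV. (h' y)\<^sup>2)"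
      using \<open>X \<subseteq> _\<close> by (intro mult_mono sum_mono2 finite_PiE_UNIV fin fin' sum_nonneg) (auto simp: \<phi>_def)
    also have "\<dots> \<le> (exp c * exp (- 2 * \<alpha> * card S)) * (exp c * exp (- 2 * \<alpha> * card T))"
      by (intro mult_mono h h' sum_nonneg) auto
    also have "\<dots> = (exp c * exp (- \<alpha> * (real (card S) + real (card T))))\<^sup>2"
      by (simp add: power2_eq_square algebra_simps flip: exp_add)
    finally show "(\<Sum>x\<in>X. h x * h' (\<phi> x)) \<le> exp c * exp (- \<alpha> * (real (card S) + real (card T)))"
      by (rule power2_le_imp_le) simp
  qed simp
  finally show ?thesis .
qed

text \<open>A match at distance \<open>d\<close> makes the configuration periodic with period
  \<open>d\<close> from site \<open>i + 1\<close> to \<open>j + int k\<close>. The first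
  \<open>min d k\<close> sites therefore determine the word at \<open>j\<close>, and conversely the
  match copies that word back.\<close>

lemma prob_match_le:
  assumes k: "k \<ge> 1" and "i \<noteq> j"
  shows "prob (match k i j) \<le> exp (12 * D) * exp (- \<alpha> * (real k + min (real k) (real_of_int \<bar>i - j\<bar>)))"
  using \<open>i \<noteq> j\<close>
proof (induction i j rule: linorder_wlog)
  case (sym i j)
  then show ?case by (simp add: match_commute[of k i] abs_minus_commute)
next
  case (le i j)
  define d where "d = nat (j - i)"
  have d: "d \<ge> 1" "j = i + int d" using le by (auto simp: d_def)
  let ?S = "block i (min d k)" and ?T = "block j k"
  have "(UNIV :: (int \<Rightarrow> 'a) set) \<in> sets (coord_algebra (- (?S \<union> ?T)))"
    using sets.top[of "coord_algebra (- (?S \<union> ?T))"] by simp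
  moreover have "(\<forall>l\<in>?S. \<sigma> l = \<sigma>' l) \<longleftrightarrow> (\<forall>l\<in>?T. \<sigma> l = \<sigma>' l)"
    if \<sigma>: "\<sigma> \<in> match k i j" "\<sigma>' \<in> match k i j" for \<sigma> \<sigma>' :: "int \<Rightarrow> 'a"
  proof
    have m: "\<sigma> (i + l) = \<sigma> (j + l)" "\<sigma>' (i + l) = \<sigma>' (j + l)" if "1 \<le> l" "l \<le> int k" for l
      using \<sigma> that by (auto simp: match_def)
    show "\<forall>l\<in>?S. \<sigma> l = \<sigma>' l" if T: "\<forall>l\<in>?T. \<sigma> l = \<sigma>' l"
    proof
      fix l assume "l \<in> ?S"
      then show "\<sigma> l = \<sigma>' l" using m[of "l - i"] T by auto
    qed
    assume S: "\<forall>l\<in>?S. \<sigma> l = \<sigma>' l"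
    \<comment> \<open>Site \<open>j + l\<close> copies \<open>i + l\<close>, which lies in the first
      \<open>d\<close> sites or equals \<open>j + (l - d)\<close>.\<close>
    have *: "\<sigma> (j + int l) = \<sigma>' (j + int l)" if "1 \<le> l" "l \<le> k" for l
      using that
    proof (induction l rule: less_induct)
      case (less l)
      have "\<sigma> (i + int l) = \<sigma>' (i + int l)"
      proof (cases "l \<le> d")
        case True
        then show ?thesis using S less.prems by auto
      next
        case False
        then have "i + int l = j + int (l - d)" using d by simp
        then show ?thesis using less.IH[of "l - d"] less.prems d False by simp
      qed
      then show ?case using m[of "int l"] less.prems by simp
    qed
    show "\<forall>l\<in>?T. \<sigma> l = \<sigma>' l"
    proof
      fix l assume "l \<in> ?T"
      then show "\<sigma> l = \<sigma>' l" using *[of "nat (l - j)"] by (auto simp: nat_le_iff)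
    qed
  qed
  ultimately have "prob (match k i j \<inter> UNIV)
      \<le> exp (12 * D) * exp (- \<alpha> * (real (card ?S) + real (card ?T))) * prob UNIV"
    using k d by (intro prob_determined good_block) auto
  moreover have "real (card ?S) + real (card ?T) = real k + min (real k) (real_of_int \<bar>i - j\<bar>)"
    using d by (auto simp: min_def)
  ultimately show ?case using prob_space by (simp add: add.commute)
qed

text \<open>Two words that overlap or just touch fill one block of length
  \<open>k + \<bar>i - i'\<bar>\<close>; otherwise they are disjoint blocks, and the two constants
  \<open>12 * D\<close> add up.\<close>

lemma good_window:
  assumes k: "k \<ge> 1"
  shows "good (24 * D) (block i k \<union> block i' k)"
    and "real (card (block i k \<union> block i' k)) = real k + min (real k) (real_of_int \<bar>i - i'\<bar>)"
proof -
  have "good (24 * D) (block i k \<union> block i' k) \<and>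
      real (card (block i k \<union> block i' k)) = real k + min (real k) (real_of_int \<bar>i - i'\<bar>)"
  proof (induction i i' rule: linorder_wlog)
    case (sym i i')
    then show ?case by (simp add: Un_commute abs_minus_commute)
  next
    case (le i i')
    show ?case
    proof (cases "i' - i \<le> int k")
      case True
      then have eq: "block i k \<union> block i' k = block i (k + nat (i' - i))" using le by auto
      have "good (24 * D) (block i (k + nat (i' - i)))"
        by (rule good_mono[OF good_block]) (use k D_nonneg in auto)
      then show ?thesis unfolding eq using le True by simp
    next
      case False
      then have disj: "block i k \<inter> block i' k = {}" by auto
      have "good (12 * D + 12 * D) (block i k \<union> block i' k)"
        by (intro good_Un good_block k disj)
      then show ?thesis using False by (simp add: card_Un_disjoint disj)
    qed
  qed
  then show "good (24 * D) (block i k \<union> block i' k)"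
    "real (card (block i k \<union> block i' k)) = real k + min (real k) (real_of_int \<bar>i - i'\<bar>)" by auto
qed

text \<open>With all first words separated from all second words, the matches copy \<open>S\<close>
  and \<open>T\<close> into each other letter by letter. The bound factors into a term in
  \<open>i\<close>, \<open>i'\<close> and one in \<open>j\<close>, \<open>j'\<close>, so sums over
  pairs of matches factor too.\<close>

lemma prob_match_pair_le:
  fixes i i' j j' k
  defines "S \<equiv> block i k \<union> block i' k" and "T \<equiv> block j k \<union> block j' k"
  assumes k: "k \<ge> 1" and disj: "S \<inter> T = {}" and R: "R \<in> sets (coord_algebra (- (S \<union> T)))"
  shows "prob (match k i j \<inter> match k i' j' \<inter> R) \<le> exp (24 * D) *
    (exp (- \<alpha> * (real k + min (real k) (real_of_int \<bar>i - i'\<bar>))) *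
     exp (- \<alpha> * (real k + min (real k) (real_of_int \<bar>j - j'\<bar>)))) * prob R"
proof -
  have "(\<forall>l\<in>S. \<sigma> l = \<sigma>' l) \<longleftrightarrow> (\<forall>l\<in>T. \<sigma> l = \<sigma>' l)"
    if \<sigma>: "\<sigma> \<in> match k i j \<inter> match k i' j'" "\<sigma>' \<in> match k i j \<inter> match k i' j'"
    for \<sigma> \<sigma>' :: "int \<Rightarrow> 'a"
  proof -
    have split: "(\<forall>l\<in>block a k. Q l) \<longleftrightarrow> (\<forall>l\<in>{1..int k}. Q (a + l))" for a and Q :: "int \<Rightarrow> bool"
    proof
      assume Q: "\<forall>l\<in>{1..int k}. Q (a + l)"
      show "\<forall>l\<in>block a k. Q l"
      proof
        fix l assume "l \<in> block a k"
        then show "Q l" using bspec[OF Q, of "l - a"] by simp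
      qed
    qed auto
    show ?thesis
      unfolding S_def T_def ball_Un split using \<sigma> by (auto simp: match_def)
  qed
  then have "prob (match k i j \<inter> match k i' j' \<inter> R)
      \<le> exp (24 * D) * exp (- \<alpha> * (real (card S) + real (card T))) * prob R"
    by (intro prob_determined disj R) (auto simp: S_def T_def intro: good_window[OF k])
  moreover have "real (card S) + real (card T) = (real k + min (real k) (real_of_int \<bar>i - i'\<bar>))
      + (real k + min (real k) (real_of_int \<bar>j - j'\<bar>))"
    unfolding S_def T_def good_window(2)[OF k] ..
  ultimately show ?thesis by (simp only: exp_add[symmetric] distrib_left)
qed

text \<open>Summing over the common word: two lower bounds from \<open>prob_block\<close> cost
  \<open>8 * D\<close>, and the sum of squares costs \<open>4 * D\<close>. Translation invariance
  gives the copy the same weight.\<close>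

lemma prob_match_ge:
  assumes k: "k \<ge> 1" and disj: "block i k \<inter> block j k = {}"
    and R: "R \<in> sets (coord_algebra (- (block i k \<union> block j k)))"
  shows "exp (- 12 * D) * exp (- 2 * \<alpha> * real k) * prob R \<le> prob (match k i j \<inter> R)"
proof -
  let ?S = "block i k" and ?T = "block j k"
  \<comment> \<open>The copy of \<open>x\<close> on the second block: its letter at
    \<open>j + l\<close> is \<open>x (i + l)\<close>.\<close>
  define y where "y x = restrict (shift (i - j) x) ?T" for x :: "int \<Rightarrow> 'a"
  have weight: "word_weight U ?T (y x) = word_weight U ?S x" for x
  proof -
    have T: "?T = (+) (j - i) ` ?S" by simp
    have "energy U ?T (y x) = energy U ?T (shift (i - j) x)"
      unfolding y_def by (rule energy_restrict)
    also have "\<dots> = energy U ?S x"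
      by (subst T) (simp only: energy_translate, simp)
    finally show ?thesis by (simp only: word_weight_def partition_sum_block[of i] partition_sum_block[of j])
  qed
  let ?C = "\<lambda>x. {\<sigma>. restrict \<sigma> ?S = x} \<inter> ({\<sigma>. restrict \<sigma> ?T = y x} \<inter> R)"
  have cyl: "{\<sigma>. restrict \<sigma> ?T = z} \<in> sets (coord_algebra (- ?S))" for z :: "int \<Rightarrow> 'a"
    using cylinder_in_coord_algebra[of ?T z] coord_algebra_mono[of ?T "- ?S"] disj by blast
  have R1: "R \<in> sets (coord_algebra (- ?S))" "R \<in> sets (coord_algebra (- ?T))"
    using R coord_algebra_mono[of "- (?S \<union> ?T)"] by blast+
  have ev: "?C x \<in> events" for x
    using cylinder_in_coord_algebra[of ?S x] cyl R1 by (intro sets.Int) auto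
  have fin: "finite (?S \<rightarrow>\<^sub>E (UNIV :: 'a set))" by (intro finite_PiE_UNIV) simp
  have "exp (- 12 * D) * exp (- 2 * \<alpha> * real k) * prob R
      = exp (- 8 * D) * (exp (- 4 * D) * exp (- 2 * \<alpha> * real k)) * prob R"
    by (simp flip: exp_add)
  also have "\<dots> \<le> exp (- 8 * D) * (\<Sum>x\<in>?S \<rightarrow>\<^sub>E UNIV. (word_weight U ?S x)\<^sup>2) * prob R"
    unfolding \<alpha>_def by (intro mult_right_mono mult_left_mono sum_sq_word_weight) auto
  also have "\<dots> = (\<Sum>x\<in>?S \<rightarrow>\<^sub>E UNIV. exp (- 4 * D) * word_weight U ?S x *
      (exp (- 4 * D) * word_weight U ?T (y x) * prob R))"
  proof -
    have exp8: "exp (- 8 * D) = exp (- 4 * D) * exp (- 4 * D)" by (simp flip: exp_add)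
    show ?thesis
      unfolding exp8 weight power2_eq_square sum_distrib_left sum_distrib_right by (simp only: mult_ac)
  qed
  also have "\<dots> \<le> (\<Sum>x\<in>?S \<rightarrow>\<^sub>E UNIV. prob (?C x))"
  proof (rule sum_mono)
    fix x :: "int \<Rightarrow> 'a" assume x: "x \<in> ?S \<rightarrow>\<^sub>E UNIV"
    have "exp (- 4 * D) * word_weight U ?S x * (exp (- 4 * D) * word_weight U ?T (y x) * prob R)
        \<le> exp (- 4 * D) * word_weight U ?S x * prob ({\<sigma>. restrict \<sigma> ?T = y x} \<inter> R)"
      using R1 k by (intro mult_left_mono prob_block mult_nonneg_nonneg word_weight_nonneg) (auto simp: y_def)
    also have "\<dots> \<le> prob (?C x)" using x k cyl R1 by (intro prob_block sets.Int) auto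
    finally show "exp (- 4 * D) * word_weight U ?S x * (exp (- 4 * D) * word_weight U ?T (y x) * prob R)
        \<le> prob (?C x)" .
  qed
  also have "\<dots> = prob (\<Union>x\<in>?S \<rightarrow>\<^sub>E UNIV. ?C x)"
    using fin ev by (intro finite_measure_finite_Union[symmetric]) (auto simp: disjoint_family_on_def)
  also have "\<dots> \<le> prob (match k i j \<inter> R)"
  proof (rule finite_measure_mono)
    show "(\<Union>x\<in>?S \<rightarrow>\<^sub>E UNIV. ?C x) \<subseteq> match k i j \<inter> R"
    proof
      fix \<sigma> assume "\<sigma> \<in> (\<Union>x\<in>?S \<rightarrow>\<^sub>E UNIV. ?C x)"
      then have \<sigma>: "restrict \<sigma> ?T = y (restrict \<sigma> ?S)" "\<sigma> \<in> R" by auto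
      have "\<sigma> (i + l) = \<sigma> (j + l)" if "l \<in> {1..int k}" for l
        using fun_cong[OF \<sigma>(1), of "j + l"] that by (simp add: y_def shift_def)
      then show "\<sigma> \<in> match k i j \<inter> R" using \<sigma>(2) by (simp add: match_def)
    qed
  qed (use R1 in auto)
  finally show ?thesis .
qed

end

section \<open>Moments of the number of matches\<close>

lemma shift_matches_eq:
  "shift_matches \<sigma> n k = 1 / 2 *
    (\<Sum>i\<in>{0..int n - k}. \<Sum>j\<in>{0..int n - k} - {i}. indicator (match (nat k) i j) \<sigma>)"
  unfolding shift_matches_def
  by (intro arg_cong[where f = "(*) (1 / 2)"] sum.cong refl)
    (auto simp: match_def shift_def indicator_def fun_eq_iff restrict_def)

lemma shift_matches_nonneg: "0 \<le> shift_matches \<sigma> n k"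
  unfolding shift_matches_def by (intro mult_nonneg_nonneg sum_nonneg) auto

text \<open>The double sum counts ordered pairs. The resulting gap between 0 and 1/2 shows that mass
  stays away from zero.\<close>

lemma shift_matches_half_nat: "\<exists>t::nat. shift_matches \<sigma> n k = real t / 2"
proof
  show "shift_matches \<sigma> n k = real (\<Sum>i\<in>{0..int n - k}. \<Sum>j\<in>{0..int n - k} - {i}.
      of_bool (restrict (shift i \<sigma>) {1..k} = restrict (shift j \<sigma>) {1..k})) / 2"
    by (simp add: shift_matches_def)
qed

lemma has_match_mono:
  "a \<le> a' \<Longrightarrow> a' + int L' \<le> a + int L \<Longrightarrow> has_match k a' L' \<subseteq> has_match k a L"
  by (force simp: has_match_def)

text \<open>Matches found in disjoint intervals have distinct first positions.\<close>

lemma shift_matches_ge_groups: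
  assumes k: "k \<ge> 1" and len: "M * l \<le> n"
    and has: "\<And>g. g < M \<Longrightarrow> \<sigma> \<in> has_match k (int (g * l)) l"
  shows "real M / 2 \<le> shift_matches \<sigma> n (int k)"
proof -
  have "\<exists>i j. int (g * l) \<le> i \<and> i < j \<and> j + int k \<le> int (g * l) + int l \<and> \<sigma> \<in> match k i j"
    if "g < M" for g
    using has[OF that] by (force simp: has_match_def)
  then obtain p q where pq: "\<And>g. g < M \<Longrightarrow> int (g * l) \<le> p g"
      "\<And>g. g < M \<Longrightarrow> p g < q g" "\<And>g. g < M \<Longrightarrow> q g + int k \<le> int (g * l) + int l"
      "\<And>g. g < M \<Longrightarrow> \<sigma> \<in> match k (p g) (q g)"
    by metis
  have le: "int (g * l) + int l \<le> int (g' * l)" if "g < g'" for g g'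
  proof -
    have "Suc g * l \<le> g' * l" using that by (intro mult_le_mono1) simp
    then have "int (Suc g * l) \<le> int (g' * l)" by (simp only: of_nat_le_iff)
    then show ?thesis by (simp add: algebra_simps)
  qed
  let ?I = "{0..int n - int k}"
  let ?f = "\<lambda>i. \<Sum>j\<in>?I - {i}. indicator (match k i j) \<sigma> :: real"
  have "p g < p g'" if "g < g'" "g' < M" for g g'
    using pq(1)[of g'] pq(2,3)[of g] le[OF that(1)] that k by linarith
  then have inj: "inj_on p {..<M}" by (intro linorder_inj_onI') (metis lessThan_iff order_less_irrefl)+
  have I: "p g \<in> ?I" "q g \<in> ?I - {p g}" if "g < M" for g
  proof -
    have "int (g * l) + int l \<le> int n" using le[OF that] len by linarith
    moreover have "0 \<le> int (g * l)" by simp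
    ultimately have "0 \<le> p g" "q g + int k \<le> int n" using pq(1,3)[OF that] by linarith+
    then show "p g \<in> ?I" "q g \<in> ?I - {p g}" using pq(2)[OF that] by auto
  qed
  have one: "1 \<le> ?f (p g)" if "g < M" for g
  proof -
    have "1 = (\<Sum>j\<in>{q g}. indicator (match k (p g) j) \<sigma> :: real)" using pq(4)[OF that] by simp
    also have "\<dots> \<le> ?f (p g)" using I[OF that] by (intro sum_mono2) auto
    finally show ?thesis .
  qed
  \<comment> \<open>Each match is counted only as the ordered pair \<open>(p g, q g)\<close>, so the
    factor 1/2 in \<open>shift_matches\<close> leaves \<open>M / 2\<close>.\<close>
  have "real M = (\<Sum>g\<in>{..<M}. 1)" by simp
  also have "\<dots> \<le> (\<Sum>g\<in>{..<M}. ?f (p g))" using one by (intro sum_mono) auto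
  also have "\<dots> = (\<Sum>i\<in>p ` {..<M}. ?f i)" by (simp add: sum.reindex[OF inj])
  also have "\<dots> \<le> (\<Sum>i\<in>?I. ?f i)" using I by (intro sum_mono2 sum_nonneg) auto
  finally show ?thesis by (simp add: shift_matches_eq)
qed

lemma sum_Times_product:
  fixes f :: "'i \<Rightarrow> 'b::comm_semiring_0"
  shows "(\<Sum>p\<in>I \<times> J. f (fst p) * g (snd p)) = sum f I * sum g J"
  by (simp add: sum_product sum.cartesian_product case_prod_unfold)

context gibbs
begin

definition G :: real where "G = 2 / (1 - exp (- \<alpha>))"

lemma G_pos: "0 < G"
  unfolding G_def using \<alpha>_pos by simp

text \<open>Pairs at distance at least \<open>k\<close> contribute \<open>x\<^sup>2\<close>; closer
  pairs, the diagonal included, contribute a geometric series and hence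
  \<open>G * x\<close>.\<close>

lemma sum_window_le:
  fixes I :: "int set" and k :: nat
  assumes "finite I"
  defines "x \<equiv> real (card I) * exp (- \<alpha> * real k)"
  shows "(\<Sum>i\<in>I. \<Sum>j\<in>I. exp (- \<alpha> * (real k + min (real k) (real_of_int \<bar>i - j\<bar>)))) \<le> x\<^sup>2 + G * x"
proof -
  let ?e = "exp (- \<alpha> * real k)"
  have "exp (- \<alpha> * (real k + min (real k) (real_of_int \<bar>i - j\<bar>)))
      \<le> ?e * ?e + ?e * exp (- (\<alpha> * real_of_int \<bar>i - j\<bar>))" for i j
    by (cases "real k \<le> real_of_int \<bar>i - j\<bar>") (simp_all add: min_def algebra_simps flip: exp_add)
  then have "(\<Sum>i\<in>I. \<Sum>j\<in>I. exp (- \<alpha> * (real k + min (real k) (real_of_int \<bar>i - j\<bar>))))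
      \<le> (\<Sum>i\<in>I. \<Sum>j\<in>I. ?e * ?e + ?e * exp (- (\<alpha> * real_of_int \<bar>i - j\<bar>)))"
    by (intro sum_mono)
  also have "\<dots> = (\<Sum>i\<in>I. real (card I) * (?e * ?e) + ?e * (\<Sum>j\<in>I. exp (- (\<alpha> * real_of_int \<bar>i - j\<bar>))))"
    by (simp add: sum.distrib sum_distrib_left)
  also have "\<dots> \<le> (\<Sum>i\<in>I. real (card I) * (?e * ?e) + ?e * G)"
    unfolding G_def using \<alpha>_pos assms(1)
    by (intro sum_mono add_left_mono mult_left_mono sum_exp_dist_le) auto
  also have "\<dots> = x\<^sup>2 + G * x" by (simp add: x_def power2_eq_square algebra_simps)
  finally show ?thesis .
qed

lemma shift_matches_measurable [measurable]:
  "(\<lambda>\<sigma>. shift_matches \<sigma> n k) \<in> borel_measurable P"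
  unfolding shift_matches_eq
  by (intro borel_measurable_times borel_measurable_const borel_measurable_sum borel_measurable_indicator)
    auto

lemma shift_matches_integrable: "integrable P (\<lambda>\<sigma>. shift_matches \<sigma> n k)"
  unfolding shift_matches_eq
  by (intro integrable_mult_right Bochner_Integration.integrable_sum integrable_real_indicator)
    (auto simp: less_top[symmetric])

lemma expectation_shift_matches_le:
  fixes n k :: nat
  assumes k: "k \<ge> 1"
  defines "x \<equiv> real n * exp (- \<alpha> * real k)"
  shows "expectation (\<lambda>\<sigma>. shift_matches \<sigma> n (int k)) \<le> exp (12 * D) * (x\<^sup>2 + G * x)"
proof -
  let ?I = "{0..int n - int k}"
  define y where "y = real (card ?I) * exp (- \<alpha> * real k)"
  let ?W = "\<lambda>i j. exp (- \<alpha> * (real k + min (real k) (real_of_int \<bar>i - j\<bar>)))"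
  have "expectation (\<lambda>\<sigma>. shift_matches \<sigma> n (int k))
      = 1 / 2 * (\<Sum>i\<in>?I. \<Sum>j\<in>?I - {i}. prob (match k i j))"
    unfolding shift_matches_eq
    by (subst Bochner_Integration.integral_mult_right_zero)
      (simp add: less_top[symmetric] match_events Bochner_Integration.integral_sum)
  also have "\<dots> \<le> (\<Sum>i\<in>?I. \<Sum>j\<in>?I - {i}. prob (match k i j))"
    by (simp add: sum_nonneg)
  also have "\<dots> \<le> (\<Sum>i\<in>?I. \<Sum>j\<in>?I - {i}. exp (12 * D) * ?W i j)"
    using k by (intro sum_mono prob_match_le) auto
  also have "\<dots> \<le> (\<Sum>i\<in>?I. \<Sum>j\<in>?I. exp (12 * D) * ?W i j)"
    by (intro sum_mono sum_mono2) auto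
  also have "\<dots> = exp (12 * D) * (\<Sum>i\<in>?I. \<Sum>j\<in>?I. ?W i j)"
    by (simp add: sum_distrib_left)
  also have "\<dots> \<le> exp (12 * D) * (y\<^sup>2 + G * y)"
    unfolding y_def by (intro mult_left_mono sum_window_le) auto
  also have "\<dots> \<le> exp (12 * D) * (x\<^sup>2 + G * x)"
  proof -
    \<comment> \<open>There are \<open>n - k + 1\<close> starting points when
      \<open>k \<le> n\<close>, which is at most \<open>n\<close> because
      \<open>k \<ge> 1\<close>.\<close>
    have "0 \<le> y" "y \<le> x" using k by (auto simp: x_def y_def)
    then show ?thesis using G_pos by (intro mult_left_mono add_mono power_mono) auto
  qed
  finally show ?thesis .
qed

lemma prob_shift_matches_ge_le:
  assumes "m > 0"
  shows "prob {\<sigma>. m \<le> shift_matches \<sigma> n k} \<le> expectation (\<lambda>\<sigma>. shift_matches \<sigma> n k) / m"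
  using integral_Markov_inequality_measure[OF shift_matches_integrable[of n k], of "{}" m] assms
    by (simp add: shift_matches_nonneg)

text \<open>The second moment quotient
  \<open>x^4 / (x\<^sup>2 + G * x)\<^sup>2 = (x / (x + G))\<^sup>2\<close> at \<open>x = b\<close>.
  The exponent is \<open>24 * D\<close> from squaring \<open>prob_match_ge\<close> plus
  \<open>24 * D\<close> from \<open>prob_match_pair_le\<close>.\<close>

definition match_const :: "real \<Rightarrow> real" where
  "match_const b = exp (- 48 * D) * (b / (b + G))\<^sup>2"

lemma match_const_pos: "b > 0 \<Longrightarrow> 0 < match_const b"
  using G_pos by (simp add: match_const_def)

lemma match_const_le_1:
  assumes "b > 0"
  shows "match_const b \<le> 1"
proof -
  have "(b / (b + G))\<^sup>2 \<le> 1" using assms G_pos by (intro power_le_one) auto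
  then show ?thesis unfolding match_const_def using D_nonneg by (intro mult_le_one) auto
qed

text \<open>Second moment method for matches with first start in \<open>I\<close> and second start
  in \<open>J\<close>. The quotient increases with \<open>x\<close>, so a lower bound
  \<open>b\<close> for \<open>x\<close> suffices.\<close>

lemma prob_has_match_ge:
  assumes k: "k \<ge> 1" and b: "0 < b" "b \<le> real h * exp (- \<alpha> * real k)"
    and L: "2 * h + 2 * k \<le> L" and R: "R \<in> sets (coord_algebra (- block a L))"
  shows "match_const b * prob R \<le> prob (has_match k a L \<inter> R)"
proof (cases "prob R = 0")
  case True
  then show ?thesis by simp
next
  case False
  then have p: "0 < prob R" by (simp add: less_le)
  define x where "x = real h * exp (- \<alpha> * real k)"
  have x: "b \<le> x" "0 < x" using b by (auto simp: x_def)
  \<comment> \<open>The gap \<open>k\<close> keeps words started in \<open>I\<close> off words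
    started in \<open>J\<close>; the last word ends before \<open>a + 2 * h + 2 * k\<close>.\<close>
  define I J where "I = {a..<a + int h}" and "J = {a + int h + int k..<a + 2 * int h + int k}"
  have card: "card I = h" "card J = h" by (simp_all add: I_def J_def)
  have fin: "finite I" "finite J" by (simp_all add: I_def J_def)
  let ?W = "\<lambda>i j. exp (- \<alpha> * (real k + min (real k) (real_of_int \<bar>i - j\<bar>)))"
  let ?A = "\<lambda>p. match k (fst p) (snd p)"
  have sub: "block i k \<subseteq> block a L" "block j k \<subseteq> block a L" "block i k \<inter> block j' k = {}"
    if "i \<in> I" "j \<in> J" "j' \<in> J" for i j j'
    using that L by (auto simp: I_def J_def)
  have R1: "R \<in> sets (coord_algebra (- V))" if "V \<subseteq> block a L" for V
    using coord_algebra_mono[of "- block a L" "- V"] that R by blast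
  have low: "exp (- 12 * D) * x\<^sup>2 * prob R \<le> (\<Sum>p\<in>I \<times> J. prob (?A p \<inter> R))"
  proof -
    have "exp (- 12 * D) * x\<^sup>2 * prob R
        = (\<Sum>p\<in>I \<times> J. exp (- 12 * D) * exp (- 2 * \<alpha> * real k) * prob R)"
    proof -
      have "exp (- 2 * \<alpha> * real k) = exp (- \<alpha> * real k) * exp (- \<alpha> * real k)"
        by (simp flip: exp_add)
      then show ?thesis
        unfolding x_def by (simp only:) (simp add: card card_cartesian_product power2_eq_square mult_ac)
    qed
    also have "\<dots> \<le> (\<Sum>p\<in>I \<times> J. prob (?A p \<inter> R))"
      by (intro sum_mono prob_match_ge k R1) (use sub in auto)
    finally show ?thesis .
  qed
  have up: "(\<Sum>p\<in>I \<times> J. \<Sum>q\<in>I \<times> J. prob (?A p \<inter> ?A q \<inter> R)) \<le> exp (24 * D) * (x\<^sup>2 + G * x)\<^sup>2 * prob R"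
  proof -
    have "(\<Sum>p\<in>I \<times> J. \<Sum>q\<in>I \<times> J. ?W (fst p) (fst q) * ?W (snd p) (snd q))
        = (\<Sum>i\<in>I. \<Sum>i'\<in>I. ?W i i') * (\<Sum>j\<in>J. \<Sum>j'\<in>J. ?W j j')"
      unfolding sum_Times_product[of "\<lambda>i. ?W _ i" "\<lambda>j. ?W _ j"]
      by (rule sum_Times_product)
    also have "\<dots> \<le> (x\<^sup>2 + G * x) * (x\<^sup>2 + G * x)"
      using sum_window_le[OF fin(1), of k] sum_window_le[OF fin(2), of k] x G_pos
      by (intro mult_mono sum_nonneg) (auto simp: card x_def)
    finally have W: "(\<Sum>p\<in>I \<times> J. \<Sum>q\<in>I \<times> J. ?W (fst p) (fst q) * ?W (snd p) (snd q))
        \<le> (x\<^sup>2 + G * x)\<^sup>2" by (simp only: power2_eq_square)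
    have "(\<Sum>p\<in>I \<times> J. \<Sum>q\<in>I \<times> J. prob (?A p \<inter> ?A q \<inter> R))
        \<le> (\<Sum>p\<in>I \<times> J. \<Sum>q\<in>I \<times> J. exp (24 * D) * (?W (fst p) (fst q) * ?W (snd p) (snd q)) * prob R)"
    proof (intro sum_mono prob_match_pair_le k R1)
      fix p q assume pq: "p \<in> I \<times> J" "q \<in> I \<times> J"
      let ?S = "block (fst p) k \<union> block (fst q) k" and ?T = "block (snd p) k \<union> block (snd q) k"
      show "?S \<inter> ?T = {}" using pq by (auto simp: I_def J_def)
      have mem: "fst p \<in> I" "snd p \<in> J" "fst q \<in> I" "snd q \<in> J" using pq by auto
      show "?S \<union> ?T \<subseteq> block a L"
        by (intro Un_least sub(1)[OF mem(1,2,2)] sub(1)[OF mem(3,4,4)]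
            sub(2)[OF mem(1,2,2)] sub(2)[OF mem(3,4,4)])
    qed
    also have "\<dots> = exp (24 * D) * prob R *
        (\<Sum>p\<in>I \<times> J. \<Sum>q\<in>I \<times> J. ?W (fst p) (fst q) * ?W (snd p) (snd q))"
      by (simp add: sum_distrib_left mult_ac)
    also have "\<dots> \<le> exp (24 * D) * prob R * (x\<^sup>2 + G * x)\<^sup>2"
      using W by (intro mult_left_mono) auto
    finally show ?thesis by (simp only: mult_ac)
  qed
  let ?Q = "prob (has_match k a L \<inter> R)"
  have "(\<Union>p\<in>I \<times> J. ?A p) \<subseteq> has_match k a L"
  proof (rule UN_least)
    fix p assume "p \<in> I \<times> J"
    then have "fst p \<in> {a..a + int L}" "snd p \<in> {fst p + 1..a + int L - int k}"
      using L k by (auto simp: I_def J_def)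
    then show "?A p \<subseteq> has_match k a L" unfolding has_match_def by blast
  qed
  moreover have "has_match k a L \<inter> R \<in> events"
    using has_match_in_coord_algebra R by (intro sets.Int) auto
  ultimately have Q: "prob ((\<Union>p\<in>I \<times> J. ?A p) \<inter> R) \<le> ?Q"
    by (intro finite_measure_mono) auto
  have "(exp (- 12 * D) * x\<^sup>2 * prob R)\<^sup>2 \<le> (\<Sum>p\<in>I \<times> J. prob (?A p \<inter> R))\<^sup>2"
    using low by (intro power_mono) auto
  also have "\<dots> \<le> (\<Sum>p\<in>I \<times> J. \<Sum>q\<in>I \<times> J. prob (?A p \<inter> ?A q \<inter> R)) * prob ((\<Union>p\<in>I \<times> J. ?A p) \<inter> R)"
    using fin R by (intro second_moment_events) auto
  also have "\<dots> \<le> (exp (24 * D) * (x\<^sup>2 + G * x)\<^sup>2 * prob R) * ?Q"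
    using up Q by (intro mult_mono) auto
  finally have main: "(exp (- 12 * D) * x\<^sup>2 * prob R)\<^sup>2 \<le> exp (24 * D) * (x\<^sup>2 + G * x)\<^sup>2 * prob R * ?Q" .
  \<comment> \<open>The common factor to be cancelled, positive because \<open>x > 0\<close> and
    \<open>prob R > 0\<close>; one power of \<open>prob R\<close> remains on the left.\<close>
  let ?c = "exp (24 * D) * x\<^sup>2 * prob R"
  have e: "exp (- 48 * D) * exp (24 * D) = exp (- 12 * D) * exp (- 12 * D)" by (simp flip: exp_add)
  have "exp (- 48 * D) * x\<^sup>2 * prob R * ?c = (exp (- 48 * D) * exp (24 * D)) * (x\<^sup>2 * prob R)\<^sup>2"
    by (simp only: power2_eq_square mult_ac)
  also have "\<dots> = (exp (- 12 * D) * x\<^sup>2 * prob R)\<^sup>2"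
    unfolding e by (simp only: power2_eq_square mult_ac)
  also note main
  also have "exp (24 * D) * (x\<^sup>2 + G * x)\<^sup>2 * prob R * ?Q = (x + G)\<^sup>2 * ?Q * ?c"
  proof -
    have "x\<^sup>2 + G * x = x * (x + G)" by (simp add: power2_eq_square algebra_simps)
    then show ?thesis by (simp only: power_mult_distrib mult_ac)
  qed
  finally have "exp (- 48 * D) * x\<^sup>2 * prob R \<le> (x + G)\<^sup>2 * ?Q"
    by (rule mult_right_le_imp_le) (use x p in simp)
  moreover have "0 < (x + G)\<^sup>2" using x G_pos by simp
  ultimately have "exp (- 48 * D) * x\<^sup>2 * prob R / (x + G)\<^sup>2 \<le> ?Q"
    by (simp only: pos_divide_le_eq mult_ac)
  then have "exp (- 48 * D) * (x / (x + G))\<^sup>2 * prob R \<le> ?Q"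
    by (simp add: power_divide)
  moreover have "match_const b * prob R \<le> exp (- 48 * D) * (x / (x + G))\<^sup>2 * prob R"
  proof -
    have "b / (b + G) \<le> x / (x + G)" using x b G_pos by (simp add: field_simps)
    then show ?thesis unfolding match_const_def
      using b G_pos by (intro mult_right_mono mult_left_mono power_mono) auto
  qed
  ultimately show ?thesis by linarith
qed

text \<open>The absence of matches in the earlier blocks is an event outside the current one, so
  each new block multiplies the failure probability by at most
  \<open>1 - match_const b\<close>.\<close>

lemma prob_no_match_le:
  assumes k: "k \<ge> 1" and b: "0 < b" "b \<le> real h * exp (- \<alpha> * real k)" and L: "2 * h + 2 * k \<le> L"
  shows "prob (- has_match k s (r * L)) \<le> (1 - match_const b) ^ r"
proof -
  note ge = prob_has_match_ge[OF k b L]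
  define H where "H t = (has_match k (s + int (t * L)) L :: (int \<Rightarrow> 'a) set)" for t
  define Q where "Q r = (\<Inter>t\<in>{..<r}. - H t)" for r
  have Q_in: "Q r \<in> sets (coord_algebra (- block (s + int (r * L)) L))" for r
  proof -
    have "- H t \<in> sets (coord_algebra (- block (s + int (r * L)) L))" if "t < r" for t
    proof -
      have "Suc t * L \<le> r * L" using that by (intro mult_le_mono1) simp
      then have "int (Suc t * L) \<le> int (r * L)" by (simp only: of_nat_le_iff)
      then have "block (s + int (t * L)) L \<subseteq> - block (s + int (r * L)) L" by (auto simp: algebra_simps)
      then have "H t \<in> sets (coord_algebra (- block (s + int (r * L)) L))"
        unfolding H_def using has_match_in_coord_algebra coord_algebra_mono by blast
      from sets.compl_sets[OF this] show ?thesis by (simp add: Compl_eq_Diff_UNIV)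
    qed
    then show ?thesis
    proof (cases "r = 0")
      case True
      then show ?thesis using sets.top[of "coord_algebra (- block (s + int (r * L)) L)"] by (simp add: Q_def)
    qed (auto simp: Q_def intro!: sets.finite_INT)
  qed
  have H_ev: "H t \<in> events" for t unfolding H_def using has_match_in_coord_algebra by auto
  have "0 \<le> 1 - match_const b" using match_const_le_1[OF b(1)] by simp
  have "prob (Q r) \<le> (1 - match_const b) ^ r"
  proof (induction r)
    case (Suc r)
    have "Q (Suc r) = Q r - H r \<inter> Q r" by (auto simp: Q_def less_Suc_eq)
    then have "prob (Q (Suc r)) = prob (Q r) - prob (H r \<inter> Q r)"
      using H_ev Q_in[of r] by (simp add: finite_measure_Diff events_coord_algebra sets.Int)
    also have "\<dots> \<le> (1 - match_const b) * prob (Q r)"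
      using ge[OF Q_in[of r]] by (simp add: H_def algebra_simps)
    also have "\<dots> \<le> (1 - match_const b) * (1 - match_const b) ^ r"
      using Suc \<open>0 \<le> 1 - match_const b\<close> by (intro mult_left_mono)
    finally show ?case by simp
  qed simp
  moreover have "- has_match k s (r * L) \<subseteq> Q r"
  proof -
    have "H t \<subseteq> has_match k s (r * L)" if "t < r" for t
    proof -
      have "Suc t * L \<le> r * L" using that by (intro mult_le_mono1) simp
      then have "int (Suc t * L) \<le> int (r * L)" by (simp only: of_nat_le_iff)
      then show ?thesis unfolding H_def by (intro has_match_mono) (auto simp: algebra_simps)
    qed
    then show ?thesis by (auto simp: Q_def)
  qed
  ultimately show ?thesis
    using finite_measure_mono[of "- has_match k s (r * L)" "Q r"] events_coord_algebra[OF Q_in[of r]]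
    by linarith
qed

text \<open>The interval holds \<open>M\<close> groups of \<open>r\<close> blocks each. If every
  group contains a match, there are at least \<open>M / 2\<close>; the union bound covers the groups
  without one.\<close>

lemma prob_few_matches_le:
  assumes k: "k \<ge> 1" and b: "0 < b" "b \<le> real h * exp (- \<alpha> * real k)" and L: "2 * h + 2 * k \<le> L"
    and n: "M * (r * L) \<le> n"
  shows "prob {\<sigma>. shift_matches \<sigma> n (int k) < real M / 2} \<le> real M * (1 - match_const b) ^ r"
proof -
  let ?H = "\<lambda>g. has_match k (int (g * (r * L))) (r * L) :: (int \<Rightarrow> 'a) set"
  have H_ev: "- ?H g \<in> events" for g
    using sets.compl_sets[of "?H g" P] has_match_in_coord_algebra by (auto simp: Compl_eq_Diff_UNIV)
  have "{\<sigma>. shift_matches \<sigma> n (int k) < real M / 2} \<subseteq> (\<Union>g\<in>{..<M}. - ?H g)"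
    using shift_matches_ge_groups[OF k n] by (force simp: not_less[symmetric])
  then have "prob {\<sigma>. shift_matches \<sigma> n (int k) < real M / 2} \<le> prob (\<Union>g\<in>{..<M}. - ?H g)"
    using H_ev by (intro finite_measure_mono sets.finite_UN) auto
  also have "\<dots> \<le> (\<Sum>g\<in>{..<M}. prob (- ?H g))"
    using H_ev by (intro measure_UNION_le) auto
  also have "\<dots> \<le> (\<Sum>g\<in>{..<M}. (1 - match_const b) ^ r)"
    by (intro sum_mono prob_no_match_le[OF k b L])
  finally show ?thesis by simp
qed

text \<open>Windows of a quarter of the block use half of it, and \<open>k\<close> grows at most
  logarithmically, so the two words fit into the other half.\<close>

lemma eventually_block_sizes:
  fixes k :: "nat \<Rightarrow> nat"
  assumes q: "q \<ge> 1" and k: "\<forall>\<^sub>F n in sequentially. real (k n) \<le> ln (real n) / \<alpha> + K"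
  shows "\<forall>\<^sub>F n in sequentially. 2 * (n div q div 4) + 2 * k n \<le> n div q \<and>
    real n / (16 * real q) \<le> real (n div q div 4)"
proof -
  have "(\<lambda>n. (ln (real n) / \<alpha> + K) / real n) \<longlonglongrightarrow> 0"
  proof -
    have "(\<lambda>n. ln (real n) / real n * (1 / \<alpha>) + K / real n) \<longlonglongrightarrow> 0 * (1 / \<alpha>) + 0"
      by (intro tendsto_intros lim_ln_over_n lim_const_over_n)
    then show ?thesis by (simp add: add_divide_distrib mult.commute)
  qed
  then have "\<forall>\<^sub>F n in sequentially. (ln (real n) / \<alpha> + K) / real n < 1 / (16 * real q)"
    using q by (intro order_tendstoD) auto
  moreover have "\<forall>\<^sub>F n in sequentially. 32 * q \<le> n" by (rule eventually_ge_at_top)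
  ultimately show ?thesis using k
  proof eventually_elim
    case (elim n)
    have q0: "0 < real q" "0 < real n" using q elim by linarith+
    define y where "y = real n / real q"
    have "32 * real q \<le> real n" using elim(2) by linarith
    then have y: "32 \<le> y" unfolding y_def using q0 by (simp add: le_divide_eq)
    have k': "real (k n) \<le> y / 16"
    proof -
      have "ln (real n) / \<alpha> + K < 1 / (16 * real q) * real n"
        using elim(1) q0 by (simp add: pos_divide_less_eq)
      then show ?thesis using elim(3) by (simp add: y_def)
    qed
    have div: "real a / real c - 1 \<le> real (a div c)" if "c > 0" for a c :: nat
    proof -
      have "real a = real c * real (a div c) + real (a mod c)"
        by (metis mult_div_mod_eq of_nat_add of_nat_mult)
      moreover have "real (a mod c) \<le> real c" using that by (simp add: less_imp_le)
      ultimately have "real a \<le> real c * (real (a div c) + 1)" by (simp add: algebra_simps)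
      then show ?thesis using that by (simp add: field_simps)
    qed
    \<comment> \<open>Since \<open>y \<ge> 32\<close>, the two roundings are harmless:
      \<open>(y - 1) / 4 - 1 \<ge> y / 16\<close>, and \<open>2 * k \<le> y / 8\<close> is below
      \<open>(y - 1) / 2\<close>.\<close>
    have 1: "y - 1 \<le> real (n div q)" using div[of q n] q by (simp add: y_def)
    have 2: "real (n div q) / 4 - 1 \<le> real (n div q div 4)" using div[of 4 "n div q"] by simp
    have "4 * (n div q div 4) \<le> n div q" by simp
    then have "4 * real (n div q div 4) \<le> real (n div q)" by linarith
    then have "real (2 * (n div q div 4) + 2 * k n) \<le> real (n div q)" using 1 k' y by simp
    moreover have "real n / (16 * real q) = y / 16" by (simp add: y_def)
    ultimately show ?case using 1 2 y by (auto simp: of_nat_le_iff simp del: of_nat_add of_nat_mult)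
  qed
qed

end

section \<open>The subcritical, supercritical and critical regimes\<close>

context gibbs
begin

text \<open>Links the parameter of the moment bounds to the distance from the critical length: the
  three regimes are \<open>x\<close> tending to infinity, tending to 0, and staying between positive
  constants.\<close>

lemma scale_eq:
  fixes k :: nat
  assumes "n \<ge> 1"
  shows "real n * exp (- \<alpha> * real k) = exp (\<alpha> * (critical_length U n - real k))"
proof -
  have "\<alpha> * (critical_length U n - real k) = ln (real n) + - \<alpha> * real k"
    using \<alpha>_pos by (simp add: critical_length_def \<alpha>_def[symmetric] algebra_simps)
  then show ?thesis using assms by (simp only: exp_add) simp
qed

text \<open>The numbers \<open>M\<close> and \<open>r\<close> depend only on \<open>m\<close> and
  \<open>e\<close>, so the interval is cut into a fixed number of blocks. Each has length
  proportional to \<open>n\<close>, and its parameter still exceeds 1 eventually.\<close>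

lemma subcritical:
  fixes k :: "nat \<Rightarrow> nat"
  assumes k: "\<forall>\<^sub>F n in sequentially. 1 \<le> k n"
    and lim: "filterlim (\<lambda>n. critical_length U n - real (k n)) at_top sequentially"
  shows "(\<lambda>n. prob {\<sigma>. shift_matches \<sigma> n (int (k n)) \<le> real m}) \<longlonglongrightarrow> 0"
proof (rule order_tendstoI)
  show "\<forall>\<^sub>F n in sequentially. a < prob {\<sigma>. shift_matches \<sigma> n (int (k n)) \<le> real m}" if "a < 0" for a
    using that by (simp add: less_le_trans)
next
  fix e :: real assume "0 < e"
  \<comment> \<open>Then \<open>M / 2 = m + 1\<close> exceeds \<open>m\<close>.\<close>
  define M where "M = 2 * m + 2"
  have "(\<lambda>r. (1 - match_const 1) ^ r) \<longlonglongrightarrow> 0"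
    using match_const_pos[of 1] match_const_le_1[of 1] by (intro LIMSEQ_realpow_zero) auto
  then have "(\<lambda>r. real M * (1 - match_const 1) ^ r) \<longlonglongrightarrow> real M * 0"
    by (intro tendsto_mult tendsto_const)
  then have "\<forall>\<^sub>F r in sequentially. real M * (1 - match_const 1) ^ r < e"
    using \<open>0 < e\<close> by (intro order_tendstoD) auto
  then obtain r where r: "r \<ge> 1" "real M * (1 - match_const 1) ^ r < e"
    using eventually_happens'[OF sequentially_bot eventually_conj[OF eventually_ge_at_top[of 1]]] by blast
  define q where "q = M * r"
  have q: "q \<ge> 1" using r by (simp add: q_def M_def)
  have ge: "\<forall>\<^sub>F n in sequentially. c \<le> critical_length U n - real (k n)" for c
    using lim by (simp add: filterlim_at_top)
  have "\<forall>\<^sub>F n in sequentially. real (k n) \<le> ln (real n) / \<alpha> + 0"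
    using ge[of 0] by eventually_elim (simp add: critical_length_def \<alpha>_def)
  from eventually_block_sizes[OF q this] k ge[of "ln (16 * real q) / \<alpha>"] eventually_ge_at_top[of 1]
  show "\<forall>\<^sub>F n in sequentially. prob {\<sigma>. shift_matches \<sigma> n (int (k n)) \<le> real m} < e"
  proof eventually_elim
    case (elim n)
    let ?L = "n div q"
    let ?h = "?L div 4"
    have "ln (16 * real q) \<le> \<alpha> * (critical_length U n - real (k n))"
      using elim(3) \<alpha>_pos by (simp add: field_simps)
    then have "16 * real q \<le> real n * exp (- \<alpha> * real (k n))"
      unfolding scale_eq[OF elim(4)] using q by (subst ln_le_cancel_iff[symmetric]) auto
    then have "1 \<le> real n / (16 * real q) * exp (- \<alpha> * real (k n))"
      using q by (simp add: field_simps)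
    also have "\<dots> \<le> real ?h * exp (- \<alpha> * real (k n))"
      using elim(1) by (intro mult_right_mono) auto
    finally have h: "1 \<le> real ?h * exp (- \<alpha> * real (k n))" .
    have n: "M * (r * ?L) \<le> n"
      using times_div_less_eq_dividend[of q n] by (simp add: q_def mult.assoc)
    have "prob {\<sigma>. shift_matches \<sigma> n (int (k n)) \<le> real m}
        \<le> prob {\<sigma>. shift_matches \<sigma> n (int (k n)) < real M / 2}"
    proof (rule finite_measure_mono)
      have "{\<sigma> \<in> space P. shift_matches \<sigma> n (int (k n)) < real M / 2} \<in> events" by measurable
      then show "{\<sigma>. shift_matches \<sigma> n (int (k n)) < real M / 2} \<in> events" by simp
    qed (auto simp: M_def)
    also have "\<dots> \<le> real M * (1 - match_const 1) ^ r"
      using elim(1) by (intro prob_few_matches_le[OF elim(2) _ h _ n]) auto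
    finally show ?case using r(2) by linarith
  qed
qed

text \<open>Markov's inequality: the first moment bound vanishes as \<open>x\<close> tends to
  0.\<close>

lemma supercritical:
  fixes k :: "nat \<Rightarrow> nat"
  assumes k: "\<forall>\<^sub>F n in sequentially. 1 \<le> k n"
    and lim: "filterlim (\<lambda>n. real (k n) - critical_length U n) at_top sequentially"
    and m: "m > 0"
  shows "(\<lambda>n. prob {\<sigma>. m \<le> shift_matches \<sigma> n (int (k n))}) \<longlonglongrightarrow> 0"
proof -
  define x where "x n = real n * exp (- \<alpha> * real (k n))" for n
  have "filterlim (\<lambda>n. - (\<alpha> * (real (k n) - critical_length U n))) at_bot sequentially"
    using filterlim_tendsto_pos_mult_at_top[OF tendsto_const \<alpha>_pos lim]
    by (simp add: filterlim_uminus_at_top)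
  then have "(\<lambda>n. exp (- (\<alpha> * (real (k n) - critical_length U n)))) \<longlonglongrightarrow> 0"
    by (rule filterlim_compose[OF exp_at_bot])
  moreover have "\<forall>\<^sub>F n in sequentially. exp (- (\<alpha> * (real (k n) - critical_length U n))) = x n"
    using eventually_ge_at_top[of 1]
  proof eventually_elim
    case (elim n)
    have "- (\<alpha> * (real (k n) - critical_length U n)) = \<alpha> * (critical_length U n - real (k n))"
      by (simp add: algebra_simps)
    then show ?case by (simp only: x_def scale_eq[OF elim])
  qed
  ultimately have "x \<longlonglongrightarrow> 0" by (rule Lim_transform_eventually)
  then have "(\<lambda>n. exp (12 * D) * ((x n)\<^sup>2 + G * x n) / m) \<longlonglongrightarrow> exp (12 * D) * (0\<^sup>2 + G * 0) / m"
    using m by (intro tendsto_intros) auto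
  then have "(\<lambda>n. exp (12 * D) * ((x n)\<^sup>2 + G * x n) / m) \<longlonglongrightarrow> 0" by simp
  moreover have "\<forall>\<^sub>F n in sequentially. norm (prob {\<sigma>. m \<le> shift_matches \<sigma> n (int (k n))})
      \<le> exp (12 * D) * ((x n)\<^sup>2 + G * x n) / m"
    using k
  proof eventually_elim
    case (elim n)
    have "prob {\<sigma>. m \<le> shift_matches \<sigma> n (int (k n))}
        \<le> expectation (\<lambda>\<sigma>. shift_matches \<sigma> n (int (k n))) / m"
      by (rule prob_shift_matches_ge_le[OF m])
    also have "\<dots> \<le> exp (12 * D) * ((x n)\<^sup>2 + G * x n) / m"
      unfolding x_def using m by (intro divide_right_mono expectation_shift_matches_le elim) auto
    finally show ?case by simp
  qed
  ultimately show ?thesis by (rule Lim_null_comparison[rotated])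
qed

lemma critical_upper:
  fixes k :: "nat \<Rightarrow> nat"
  assumes k: "\<forall>\<^sub>F n in sequentially. 1 \<le> k n"
    and K: "\<forall>\<^sub>F n in sequentially. \<bar>real (k n) - critical_length U n\<bar> \<le> K"
  shows "\<exists>C>0. \<forall>\<^sub>F n in sequentially. expectation (\<lambda>\<sigma>. shift_matches \<sigma> n (int (k n))) \<le> C"
proof (intro exI conjI)
  let ?X = "exp (\<alpha> * K)"
  show "0 < exp (12 * D) * (?X\<^sup>2 + G * ?X)"
    using G_pos by (intro mult_pos_pos add_pos_pos) auto
  show "\<forall>\<^sub>F n in sequentially. expectation (\<lambda>\<sigma>. shift_matches \<sigma> n (int (k n)))
      \<le> exp (12 * D) * (?X\<^sup>2 + G * ?X)"
    using k K eventually_ge_at_top[of 1]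
  proof eventually_elim
    case (elim n)
    have x: "real n * exp (- \<alpha> * real (k n)) \<le> ?X"
      unfolding scale_eq[OF elim(3)] using elim(2) \<alpha>_pos by simp
    have "expectation (\<lambda>\<sigma>. shift_matches \<sigma> n (int (k n)))
        \<le> exp (12 * D) * ((real n * exp (- \<alpha> * real (k n)))\<^sup>2 + G * (real n * exp (- \<alpha> * real (k n))))"
      by (rule expectation_shift_matches_le[OF elim(1)])
    also have "\<dots> \<le> exp (12 * D) * (?X\<^sup>2 + G * ?X)"
      using x G_pos by (intro mult_left_mono add_mono power_mono) auto
    finally show ?case .
  qed
qed

lemma critical_lower:
  fixes k :: "nat \<Rightarrow> nat"
  assumes k: "\<forall>\<^sub>F n in sequentially. 1 \<le> k n"
    and K: "\<forall>\<^sub>F n in sequentially. \<bar>real (k n) - critical_length U n\<bar> \<le> K"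
  shows "\<exists>c>0. \<forall>\<^sub>F n in sequentially. c \<le> prob {\<sigma>. 0 < shift_matches \<sigma> n (int (k n))}"
proof (intro exI conjI)
  \<comment> \<open>The lower bound \<open>exp (- (\<alpha> * K))\<close> for the parameter, reduced
    by the factor 16 of \<open>eventually_block_sizes\<close> at \<open>q = 1\<close>.\<close>
  define b where "b = exp (- (\<alpha> * K)) / 16"
  have b: "b > 0" by (simp add: b_def)
  then show "0 < match_const b" by (rule match_const_pos)
  have "\<forall>\<^sub>F n in sequentially. real (k n) \<le> ln (real n) / \<alpha> + K"
    using K by eventually_elim (simp add: critical_length_def \<alpha>_def abs_le_iff)
  from eventually_block_sizes[OF order_refl this] k K eventually_ge_at_top[of 1]
  show "\<forall>\<^sub>F n in sequentially. match_const b \<le> prob {\<sigma>. 0 < shift_matches \<sigma> n (int (k n))}"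
  proof eventually_elim
    case (elim n)
    let ?N = "\<lambda>\<sigma>. shift_matches \<sigma> n (int (k n))"
    have "- (\<alpha> * K) \<le> \<alpha> * (critical_length U n - real (k n))"
      using elim(3) \<alpha>_pos mult_left_mono[of "- K" "critical_length U n - real (k n)" \<alpha>] by (simp add: abs_le_iff)
    then have "b \<le> real n * exp (- \<alpha> * real (k n)) / 16"
      unfolding scale_eq[OF elim(4)] b_def by simp
    also have "\<dots> \<le> real (n div 4) * exp (- \<alpha> * real (k n))"
      using mult_right_mono[OF conjunct2[OF elim(1)], of "exp (- \<alpha> * real (k n))"] by simp
    finally have h: "b \<le> real (n div 4) * exp (- \<alpha> * real (k n))" .
    \<comment> \<open>One group consisting of one block, the whole interval.\<close>
    have "prob {\<sigma>. ?N \<sigma> < real 1 / 2} \<le> real 1 * (1 - match_const b) ^ 1"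
      using elim(1) by (intro prob_few_matches_le[OF elim(2) b h, where L = n]) auto
    moreover have "prob {\<sigma>. \<not> ?N \<sigma> < 1 / 2} = 1 - prob {\<sigma>. ?N \<sigma> < 1 / 2}"
    proof -
      have "{\<sigma> \<in> space P. ?N \<sigma> < 1 / 2} \<in> events" by measurable
      from prob_compl[OF this] show ?thesis by (simp add: set_diff_eq)
    qed
    moreover have "prob {\<sigma>. \<not> ?N \<sigma> < 1 / 2} \<le> prob {\<sigma>. 0 < ?N \<sigma>}"
    proof (rule finite_measure_mono)
      have "{\<sigma> \<in> space P. 0 < ?N \<sigma>} \<in> events" by measurable
      then show "{\<sigma>. 0 < ?N \<sigma>} \<in> events" by simp
    qed auto
    ultimately show ?case by simp
  qed
qed

lemma tight_shift_matches:
  assumes "\<forall>\<^sub>F n in sequentially. expectation (\<lambda>\<sigma>. shift_matches \<sigma> n (k n)) \<le> C"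
  shows "tight (\<lambda>n. distr P borel (\<lambda>\<sigma>. shift_matches \<sigma> n (k n)))"
  unfolding tight_def
proof (intro conjI allI impI)
  fix n
  show "real_distribution (distr P borel (\<lambda>\<sigma>. shift_matches \<sigma> n (k n)))"
    by (rule real_distribution_distr) simp
next
  fix e :: real assume e: "0 < e"
  let ?E = "\<lambda>n. expectation (\<lambda>\<sigma>. shift_matches \<sigma> n (k n))"
  obtain n0 where n0: "\<And>n. n \<ge> n0 \<Longrightarrow> ?E n \<le> C"
    using assms by (auto simp: eventually_at_top_linorder)
  \<comment> \<open>Tightness concerns every \<open>n\<close>, so the finitely many early
    expectations are added; the final 1 makes the bound strict.\<close>
  define B where "B = \<bar>C\<bar> + (\<Sum>n<n0. ?E n) + 1"
  have E_nonneg: "0 \<le> ?E n" for n by (simp add: shift_matches_nonneg)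
  have B: "?E n < B" for n
  proof (cases "n < n0")
    case True
    then have "?E n \<le> (\<Sum>n<n0. ?E n)" using E_nonneg by (intro member_le_sum) auto
    then show ?thesis by (simp add: B_def)
  next
    case False
    then show ?thesis using n0[of n] sum_nonneg[of "{..<n0}" ?E] E_nonneg unfolding B_def by fastforce
  qed
  have "B > 0" using B[of 0] E_nonneg[of 0] by linarith
  define b where "b = B / e"
  have "b > 0" using \<open>B > 0\<close> e by (simp add: b_def)
  \<comment> \<open>The interval is open on the left, hence starts below 0 to retain the value
    0.\<close>
  have "1 - e < measure (distr P borel (\<lambda>\<sigma>. shift_matches \<sigma> n (k n))) {- 1<..b}" for n
  proof -
    let ?N = "\<lambda>\<sigma>. shift_matches \<sigma> n (k n)"
    have ev: "{\<sigma>. b \<le> ?N \<sigma>} \<in> events" "{\<sigma>. - 1 < ?N \<sigma> \<and> ?N \<sigma> \<le> b} \<in> events"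
    proof -
      have "{\<sigma> \<in> space P. b \<le> ?N \<sigma>} \<in> events" "{\<sigma> \<in> space P. - 1 < ?N \<sigma> \<and> ?N \<sigma> \<le> b} \<in> events"
        by measurable
      then show "{\<sigma>. b \<le> ?N \<sigma>} \<in> events" "{\<sigma>. - 1 < ?N \<sigma> \<and> ?N \<sigma> \<le> b} \<in> events" by simp_all
    qed
    have "prob {\<sigma>. b \<le> ?N \<sigma>} \<le> ?E n / b" by (rule prob_shift_matches_ge_le[OF \<open>b > 0\<close>])
    also have "\<dots> < B / b" using B \<open>b > 0\<close> by (intro divide_strict_right_mono)
    also have "\<dots> = e" using \<open>B > 0\<close> e by (simp add: b_def)
    finally have "prob {\<sigma>. b \<le> ?N \<sigma>} < e" .
    then have "1 - e < 1 - prob {\<sigma>. b \<le> ?N \<sigma>}" by simp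
    also have "\<dots> = prob (UNIV - {\<sigma>. b \<le> ?N \<sigma>})"
      using prob_compl[OF ev(1)] by simp
    also have "\<dots> \<le> prob {\<sigma>. - 1 < ?N \<sigma> \<and> ?N \<sigma> \<le> b}"
    proof (rule finite_measure_mono[OF _ ev(2)], safe)
      fix \<sigma> assume "\<not> b \<le> ?N \<sigma>"
      then show "- 1 < ?N \<sigma>" "?N \<sigma> \<le> b" using shift_matches_nonneg[of \<sigma> n "k n"] by linarith+
    qed
    also have "\<dots> = measure (distr P borel ?N) {- 1<..b}"
      by (subst measure_distr) (auto intro!: arg_cong[where f = prob])
    finally show ?thesis .
  qed
  then show "\<exists>a b. a < b \<and> (\<forall>n. 1 - e < measure (distr P borel (\<lambda>\<sigma>. shift_matches \<sigma> n (k n))) {a<..b})"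
    using \<open>b > 0\<close> by (intro exI[of _ "- 1"] exI[of _ b]) auto
qed

text \<open>The point 1/4 is a continuity point of the limit distribution function, with value 1,
  while a count of at most 1/4 is 0 and so has probability at most \<open>1 - c\<close>.\<close>

lemma not_weak_conv_shift_matches:
  assumes c: "c > 0" "\<forall>\<^sub>F n in sequentially. c \<le> prob {\<sigma>. 0 < shift_matches \<sigma> n (k n)}"
  shows "\<not> weak_conv_m (\<lambda>n. distr P borel (\<lambda>\<sigma>. shift_matches \<sigma> n (k n))) (return borel 0)"
proof
  let ?\<mu> = "\<lambda>n. distr P borel (\<lambda>\<sigma>. shift_matches \<sigma> n (k n))"
  assume conv: "weak_conv_m ?\<mu> (return borel 0)"
  have cdf0: "cdf (return borel 0) x = (if 0 \<le> x then 1 else 0)" for x :: real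
    by (simp add: cdf_def measure_return)
  have "\<forall>\<^sub>F x in nhds (1 / 4). (0 :: real) < x"
    using eventually_nhds_in_open[of "{0<..}" "1 / 4 :: real"] by simp
  then have "\<forall>\<^sub>F x in nhds (1 / 4). cdf (return borel 0) x = (1 :: real)"
    by eventually_elim (simp add: cdf0)
  then have "isCont (cdf (return borel 0)) (1 / 4)"
    by (subst isCont_cong[where g = "\<lambda>_. 1"]) auto
  then have "(\<lambda>n. cdf (?\<mu> n) (1 / 4)) \<longlonglongrightarrow> cdf (return borel 0) (1 / 4)"
    using conv unfolding weak_conv_m_def weak_conv_def by blast
  then have lim: "(\<lambda>n. cdf (?\<mu> n) (1 / 4)) \<longlonglongrightarrow> 1" by (simp add: cdf0)
  have "\<forall>\<^sub>F n in sequentially. cdf (?\<mu> n) (1 / 4) \<le> 1 - c"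
    using c(2)
  proof eventually_elim
    case (elim n)
    let ?N = "\<lambda>\<sigma>. shift_matches \<sigma> n (k n)"
    have ev: "{\<sigma>. 0 < ?N \<sigma>} \<in> events"
    proof -
      have "{\<sigma> \<in> space P. 0 < ?N \<sigma>} \<in> events" by measurable
      then show ?thesis by simp
    qed
    have "\<not> 0 < ?N \<sigma>" if "?N \<sigma> \<le> 1 / 4" for \<sigma>
    proof -
      obtain t :: nat where t: "?N \<sigma> = real t / 2" using shift_matches_half_nat by blast
      with that have "real t < 1" by simp
      then show ?thesis using t by simp
    qed
    then have sub: "{\<sigma>. ?N \<sigma> \<le> 1 / 4} \<subseteq> UNIV - {\<sigma>. 0 < ?N \<sigma>}" by blast
    have "cdf (?\<mu> n) (1 / 4) = prob {\<sigma>. ?N \<sigma> \<le> 1 / 4}"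
      unfolding cdf_def by (subst measure_distr) (auto intro!: arg_cong[where f = prob])
    also have "\<dots> \<le> prob (UNIV - {\<sigma>. 0 < ?N \<sigma>})"
      using sub sets.compl_sets[OF ev] by (intro finite_measure_mono) auto
    also have "\<dots> = 1 - prob {\<sigma>. 0 < ?N \<sigma>}" using prob_compl[OF ev] by simp
    finally show ?case using elim by linarith
  qed
  then have "1 \<le> 1 - c" by (rule tendsto_upperbound[OF lim]) simp
  then show False using c(1) by simp
qed

end

theorem theorem4p1:
  fixes U :: "int set \<Rightarrow> (int \<Rightarrow> 'a::finite) \<Rightarrow> real"
    and P :: "(int \<Rightarrow> 'a) measure"
    and k :: "nat \<Rightarrow> int"
  assumes "CARD('a) \<ge> 2"
    and "U \<in> interactions"
    and "gibbs_measure U P"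
    and "\<forall>\<^sub>F n in sequentially. 1 \<le> k n \<and> k n \<le> int n"
  shows "match_rate U > 0 \<and>
    (filterlim (\<lambda>n. critical_length U n - real_of_int (k n)) at_top sequentially \<longrightarrow>
      (\<forall>m::nat. m \<ge> 1 \<longrightarrow>
        (\<lambda>n. \<P>(\<sigma> in P. shift_matches \<sigma> n (k n) \<le> real m)) \<longlonglongrightarrow> 0)) \<and>
    (filterlim (\<lambda>n. real_of_int (k n) - critical_length U n) at_top sequentially \<longrightarrow>
      (\<forall>m::nat. m \<ge> 1 \<longrightarrow>
        (\<lambda>n. \<P>(\<sigma> in P. shift_matches \<sigma> n (k n) \<ge> real m)) \<longlonglongrightarrow> 0)) \<and>
    (bounded (range (\<lambda>n. real_of_int (k n) - critical_length U n)) \<longrightarrow>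
      tight (\<lambda>n. distr P borel (\<lambda>\<sigma>. shift_matches \<sigma> n (k n))) \<and>
      \<not> weak_conv_m (\<lambda>n. distr P borel (\<lambda>\<sigma>. shift_matches \<sigma> n (k n))) (return borel 0) \<and>
      (\<exists>C::real. C > 0 \<and> (\<forall>m::nat. m \<ge> 1 \<longrightarrow>
        limsup (\<lambda>n. ereal (\<P>(\<sigma> in P. shift_matches \<sigma> n (k n) > real m))) \<le> ereal (C / real m))) \<and>
      liminf (\<lambda>n. ereal (\<P>(\<sigma> in P. shift_matches \<sigma> n (k n) > 0))) > 0)"
proof -
  obtain w D where "interaction U w D" using interactions_imp_interaction[OF assms(2)] .
  then interpret interaction U w D .
  interpret gibbs U w D P by unfold_locales (fact assms)+
  \<comment> \<open>It agrees with \<open>k\<close> eventually, which suffices for limits and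
    eventual bounds; the distributions in the tightness claim keep \<open>k\<close> itself.\<close>
  define l where "l n = nat (k n)" for n
  have kl: "\<forall>\<^sub>F n in sequentially. k n = int (l n)"
    using assms(4) by eventually_elim (simp add: l_def)
  have l: "\<forall>\<^sub>F n in sequentially. 1 \<le> l n"
    using assms(4) by eventually_elim (unfold l_def, linarith)
  have sub: "(\<lambda>n. prob {\<sigma>. shift_matches \<sigma> n (k n) \<le> real m}) \<longlonglongrightarrow> 0"
    if lim: "filterlim (\<lambda>n. critical_length U n - real_of_int (k n)) at_top sequentially" for m :: nat
  proof -
    have eq: "\<forall>\<^sub>F n in sequentially. critical_length U n - real_of_int (k n) = critical_length U n - real (l n)"
      using kl by eventually_elim simp
    have "filterlim (\<lambda>n. critical_length U n - real (l n)) at_top sequentially"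
      using lim filterlim_cong[OF refl refl eq] by blast
    from subcritical[OF l this, of m] show ?thesis
      by (rule Lim_transform_eventually) (use kl in \<open>eventually_elim, simp\<close>)
  qed
  have super: "(\<lambda>n. prob {\<sigma>. real m \<le> shift_matches \<sigma> n (k n)}) \<longlonglongrightarrow> 0"
    if lim: "filterlim (\<lambda>n. real_of_int (k n) - critical_length U n) at_top sequentially"
      and "m \<ge> 1" for m :: nat
  proof -
    have eq: "\<forall>\<^sub>F n in sequentially. real_of_int (k n) - critical_length U n = real (l n) - critical_length U n"
      using kl by eventually_elim simp
    have "filterlim (\<lambda>n. real (l n) - critical_length U n) at_top sequentially"
      using lim filterlim_cong[OF refl refl eq] by blast
    from supercritical[OF l this, of "real m"] \<open>m \<ge> 1\<close>
    have "(\<lambda>n. prob {\<sigma>. real m \<le> shift_matches \<sigma> n (int (l n))}) \<longlonglongrightarrow> 0" by simp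
    then show ?thesis
      by (rule Lim_transform_eventually) (use kl in \<open>eventually_elim, simp\<close>)
  qed
  have crit: "tight (\<lambda>n. distr P borel (\<lambda>\<sigma>. shift_matches \<sigma> n (k n))) \<and>
      \<not> weak_conv_m (\<lambda>n. distr P borel (\<lambda>\<sigma>. shift_matches \<sigma> n (k n))) (return borel 0) \<and>
      (\<exists>C::real. C > 0 \<and> (\<forall>m::nat. m \<ge> 1 \<longrightarrow>
        limsup (\<lambda>n. ereal (prob {\<sigma>. shift_matches \<sigma> n (k n) > real m})) \<le> ereal (C / real m))) \<and>
      liminf (\<lambda>n. ereal (prob {\<sigma>. shift_matches \<sigma> n (k n) > 0})) > 0"
    if bdd: "bounded (range (\<lambda>n. real_of_int (k n) - critical_length U n))"
  proof -
    obtain K where K0: "\<And>n. \<bar>real_of_int (k n) - critical_length U n\<bar> \<le> K"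
      using bdd unfolding bounded_iff by (auto simp: real_norm_def)
    have K: "\<forall>\<^sub>F n in sequentially. \<bar>real (l n) - critical_length U n\<bar> \<le> K"
      using kl
    proof eventually_elim
      case (elim n)
      show ?case using K0[of n] unfolding elim by simp
    qed
    obtain C where C: "C > 0"
      and E0: "\<forall>\<^sub>F n in sequentially. expectation (\<lambda>\<sigma>. shift_matches \<sigma> n (int (l n))) \<le> C"
      using critical_upper[OF l K] by blast
    have E: "\<forall>\<^sub>F n in sequentially. expectation (\<lambda>\<sigma>. shift_matches \<sigma> n (k n)) \<le> C"
      using kl E0 by eventually_elim simp
    obtain c where c: "c > 0"
      and pos0: "\<forall>\<^sub>F n in sequentially. c \<le> prob {\<sigma>. 0 < shift_matches \<sigma> n (int (l n))}"
      using critical_lower[OF l K] by blast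
    have pos: "\<forall>\<^sub>F n in sequentially. c \<le> prob {\<sigma>. 0 < shift_matches \<sigma> n (k n)}"
      using kl pos0 by eventually_elim simp
    have "limsup (\<lambda>n. ereal (prob {\<sigma>. shift_matches \<sigma> n (k n) > real m})) \<le> ereal (C / real m)"
      if m: "m \<ge> 1" for m :: nat
    proof (rule Limsup_bounded)
      show "\<forall>\<^sub>F n in sequentially. ereal (prob {\<sigma>. shift_matches \<sigma> n (k n) > real m}) \<le> ereal (C / real m)"
        using E
      proof eventually_elim
        case (elim n)
        have "{\<sigma> \<in> space P. real m \<le> shift_matches \<sigma> n (k n)} \<in> events" by measurable
        then have "prob {\<sigma>. shift_matches \<sigma> n (k n) > real m} \<le> prob {\<sigma>. real m \<le> shift_matches \<sigma> n (k n)}"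
          by (intro finite_measure_mono) auto
        also have "\<dots> \<le> expectation (\<lambda>\<sigma>. shift_matches \<sigma> n (k n)) / real m"
          using m by (intro prob_shift_matches_ge_le) simp
        also have "\<dots> \<le> C / real m" using elim by (intro divide_right_mono) auto
        finally show ?case by simp
      qed
    qed
    moreover have "ereal c \<le> liminf (\<lambda>n. ereal (prob {\<sigma>. shift_matches \<sigma> n (k n) > 0}))"
      by (rule Liminf_bounded) (use pos in \<open>eventually_elim, simp\<close>)
    then have "0 < liminf (\<lambda>n. ereal (prob {\<sigma>. shift_matches \<sigma> n (k n) > 0}))"
      using c by (auto intro: less_le_trans[of 0 "ereal c"])
    ultimately show ?thesis
      using tight_shift_matches[OF E] not_weak_conv_shift_matches[OF c pos] C by blast
  qed
  have "{\<sigma> \<in> space P. Q \<sigma>} = {\<sigma>. Q \<sigma>}" for Q by simp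
  then show ?thesis
    using \<alpha>_pos sub super crit unfolding \<alpha>_def by (simp only:) blast
qed

end
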